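(* Let $T_{\mathfrak{so}_5} \in \mathfrak{so}_5^* \otimes \mathfrak{so}_5^* \otimes \mathfrak{so}_5$ be the structure tensor of the complex Lie algebra $\mathfrak{so}_5$. Then its border rank satisfies $\underline{\mathbf{R}}(T_{\mathfrak{so}_5}) \geq 19$.
   Context: $\mathfrak{so}_n$ denotes the complex Lie algebra of skew-symmetric $n\times n$ complex matrices with bracket $[x,y]=xy-yx$ (note $\mathfrak{so}_5\simeq\mathfrak{sp}_4$). For a Lie algebra $\mathfrak{g}$, its structure tensor $T_{\mathfrak{g}}\in\mathfrak{g}^*\otimes\mathfrak{g}^*\otimes\mathfrak{g}$ is the tensor corresponding to the bilinear map $(x,y)\mapsto[x,y]$; in a basis $\{a_i\}$ with dual basis $\{\alpha^i\}$ and $[a_i,a_j]=\sum_k A_{ij}^k a_k$, it is $\sum_{i,j,k}A_{ij}^k\,\alpha^i\otimes\alpha^j\otimes a_k$. For a tensor $T\in A\otimes B\otimes C$ over $\mathbb{C}$, the rank of $T$ is the minimal $r$ with $T=\sum_{i=1}^r a_i\otimes b_i\otimes c_i$, and the border rank $\underline{\mathbf{R}}(T)$ is the minimal $r$ such that $T=\lim_{\epsilon\to 0}T_\epsilon$ with each $T_\epsilon$ of rank at most $r$. *)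

theory Defs
  imports "HOL-Analysis.Analysis"
begin

text \<open>Tensors in \<open>\<complex>^A \<otimes> \<complex>^B \<otimes> \<complex>^C\<close> for finite index sets A, B, C are
  represented by their coordinate functions \<open>T a b c\<close> (only values on A \<times> B \<times> C matter).\<close>

definition tensor_rank_le ::
  "'a set \<Rightarrow> 'b set \<Rightarrow> 'c set \<Rightarrow> ('a \<Rightarrow> 'b \<Rightarrow> 'c \<Rightarrow> complex) \<Rightarrow> nat \<Rightarrow> bool" where
  "tensor_rank_le A B C T r \<longleftrightarrow>
     (\<exists>(u :: nat \<Rightarrow> 'a \<Rightarrow> complex) (v :: nat \<Rightarrow> 'b \<Rightarrow> complex) (w :: nat \<Rightarrow> 'c \<Rightarrow> complex).
        \<forall>a\<in>A. \<forall>b\<in>B. \<forall>c\<in>C. T a b c = (\<Sum>l<r. u l a * v l b * w l c))"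

definition border_rank_le ::
  "'a set \<Rightarrow> 'b set \<Rightarrow> 'c set \<Rightarrow> ('a \<Rightarrow> 'b \<Rightarrow> 'c \<Rightarrow> complex) \<Rightarrow> nat \<Rightarrow> bool" where
  "border_rank_le A B C T r \<longleftrightarrow>
     (\<exists>S :: nat \<Rightarrow> 'a \<Rightarrow> 'b \<Rightarrow> 'c \<Rightarrow> complex.
        (\<forall>n. tensor_rank_le A B C (S n) r) \<and>
        (\<forall>a\<in>A. \<forall>b\<in>B. \<forall>c\<in>C. (\<lambda>n. S n a b c) \<longlonglongrightarrow> T a b c))"

definition border_rank ::
  "'a set \<Rightarrow> 'b set \<Rightarrow> 'c set \<Rightarrow> ('a \<Rightarrow> 'b \<Rightarrow> 'c \<Rightarrow> complex) \<Rightarrow> nat" where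
  "border_rank A B C T = (LEAST r. border_rank_le A B C T r)"

definition mat_mult5 :: "(nat \<Rightarrow> nat \<Rightarrow> complex) \<Rightarrow> (nat \<Rightarrow> nat \<Rightarrow> complex) \<Rightarrow> nat \<Rightarrow> nat \<Rightarrow> complex" where
  "mat_mult5 X Y = (\<lambda>i j. \<Sum>k<5. X i k * Y k j)"

definition bracket5 :: "(nat \<Rightarrow> nat \<Rightarrow> complex) \<Rightarrow> (nat \<Rightarrow> nat \<Rightarrow> complex) \<Rightarrow> nat \<Rightarrow> nat \<Rightarrow> complex" where
  "bracket5 X Y = (\<lambda>i j. mat_mult5 X Y i j - mat_mult5 Y X i j)"

definition so5_index :: "(nat \<times> nat) set" where
  "so5_index = {(i, j). i < j \<and> j < 5}"

definition so5_basis :: "nat \<times> nat \<Rightarrow> nat \<Rightarrow> nat \<Rightarrow> complex" where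
  "so5_basis p = (\<lambda>r s. if (r, s) = p then 1 else if (s, r) = p then -1 else 0)"

text \<open>Structure tensor: coordinate k=(i,j) of [a_p, a_q] in the basis above is its (i,j) entry
  (the dual basis functional of E_ij - E_ji on skew matrices is X \<mapsto> X i j).\<close>
definition T_so5 :: "nat \<times> nat \<Rightarrow> nat \<times> nat \<Rightarrow> nat \<times> nat \<Rightarrow> complex" where
  "T_so5 p q k = bracket5 (so5_basis p) (so5_basis q) (fst k) (snd k)"

end

theory Submission
  imports Defs "Jordan_Normal_Form.Determinant"
begin

text \<open>
  In an isotropic basis the bracket tensor is a weight tensor, invariant under isometries. If it had border
  rank at most 18, then killing one rank-one summand of the approximating tensors shows that, modulo
  some vector of the first factor, its border rank is at most 17. The set of such vectors is closed and invariant,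
  so unipotent one-parameter groups move this vector to the highest weight vector \<open>f\<^sub>0 \<and> f\<^sub>1\<close>. Repeating the
  argument modulo \<open>f\<^sub>0 \<and> f\<^sub>1\<close> kills \<open>f\<^sub>0 \<and> f\<^sub>2\<close> as well and leaves border rank at most 16. On a suitable
  7-dimensional space of the remaining slices, the Koszul flattening \<open>\<Lambda>\<^sup>3 \<otimes> \<complex>\<^sup>1\<^sup>0 \<rightarrow> \<Lambda>\<^sup>4 \<otimes> \<complex>\<^sup>1\<^sup>0\<close> has rank 322,
  whereas a tensor of rank one contributes at most 20, which would give at most \<open>16 * 20 = 320\<close>.
\<close>

section \<open>Border rank under linear maps and limits\<close>

text \<open>A Koszul flattening alone cannot reach 19: on a space of dimension
  \<open>n \<le> 10\<close> in the first factor, its rank divided by the contribution of a rank-one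
  tensor is at most 18, the best case being \<open>126 * 10 / 70\<close> at \<open>n = 9\<close>.
  Each substitution adds one to the bound, so two of them followed by a bound of 17 suffice. Eight
  slices are then left, the largest odd dimension is 7, and the flattening is a 350 by 350 matrix of
  which rank 321 is wanted. The rank found exceeds this by one only, so the choice of the seven
  slices is delicate. The obstacle is that substitution kills an unknown vector. Borel's fixed point
  theorem would replace it by a highest weight vector; here the leading coefficients of two explicit
  one-parameter orbits do the same. Only closed conditions are carried along: border rank at most
  \<open>r\<close>, or the vanishing of a minor. The nonvanishing of the final minor is certified by
  integer elimination.\<close>

lemma tensor_rank_leI:
  assumes "finite L" "card L \<le> r"
    and T: "\<And>a b c. a \<in> A \<Longrightarrow> b \<in> B \<Longrightarrow> c \<in> C \<Longrightarrow> T a b c = (\<Sum>l\<in>L. u l a * v l b * w l c)"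
  shows "tensor_rank_le A B C T r"
proof -
  obtain h where h: "bij_betw h {..<card L} L"
    using ex_bij_betw_nat_finite[OF \<open>finite L\<close>] by (auto simp: atLeast0LessThan)
  define u' where "u' = (\<lambda>l. if l < card L then u (h l) else (\<lambda>_. 0))"
  have "T a b c = (\<Sum>l<r. u' l a * v (h l) b * w (h l) c)"
    if "a \<in> A" "b \<in> B" "c \<in> C" for a b c
  proof -
    have "T a b c = (\<Sum>l<card L. u (h l) a * v (h l) b * w (h l) c)"
      unfolding T[OF that] using sum.reindex_bij_betw[OF h, of "\<lambda>l. u l a * v l b * w l c"] by simp
    also have "\<dots> = (\<Sum>l<r. u' l a * v (h l) b * w (h l) c)"
      using \<open>card L \<le> r\<close> by (intro sum.mono_neutral_cong_left) (auto simp: u'_def)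
    finally show ?thesis .
  qed
  then show ?thesis
    unfolding tensor_rank_le_def by (intro exI[of _ u'] exI[of _ "\<lambda>l. v (h l)"] exI[of _ "\<lambda>l. w (h l)"]) auto
qed

lemma tensor_rank_le_mono:
  assumes "tensor_rank_le A B C T r" "r \<le> s"
  shows "tensor_rank_le A B C T s"
proof -
  obtain u v w where "\<forall>a\<in>A. \<forall>b\<in>B. \<forall>c\<in>C. T a b c = (\<Sum>l<r. u l a * v l b * w l c)"
    using assms(1) unfolding tensor_rank_le_def by blast
  then show ?thesis
    using assms(2) by (intro tensor_rank_leI[of "{..<r}" s _ _ _ _ u v w]) auto
qed

text \<open>Makes the set under the \<open>LEAST\<close> in \<open>border_rank\<close> nonempty, so
  that the minimum is attained.\<close>

lemma tensor_rank_le_exists: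
  assumes "finite A" "finite B"
  shows "\<exists>r. tensor_rank_le A B C T r"
proof -
  have "T a b c = (\<Sum>l\<in>A \<times> B. (if a = fst l then 1 else 0) * (if b = snd l then 1 else 0) * T (fst l) (snd l) c)"
    if "a \<in> A" "b \<in> B" for a b c
  proof -
    have "(\<Sum>l\<in>A \<times> B. (if a = fst l then 1 else 0) * (if b = snd l then 1 else 0) * T (fst l) (snd l) c)
        = (\<Sum>l\<in>A \<times> B. if l = (a, b) then T a b c else 0)"
      by (intro sum.cong) auto
    also have "\<dots> = T a b c"
      using that assms by simp
    finally show ?thesis ..
  qed
  then have "tensor_rank_le A B C T (card (A \<times> B))"
    by (intro tensor_rank_leI[of "A \<times> B" _ _ _ _ _ "\<lambda>l a. if a = fst l then 1 else 0"
          "\<lambda>l b. if b = snd l then 1 else 0" "\<lambda>l. T (fst l) (snd l)"])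
      (use assms in \<open>auto simp del: card_cartesian_product\<close>)
  then show ?thesis ..
qed

definition tensor_map ::
  "'a set \<Rightarrow> 'b set \<Rightarrow> 'c set \<Rightarrow> ('d \<Rightarrow> 'a \<Rightarrow> complex) \<Rightarrow> ('e \<Rightarrow> 'b \<Rightarrow> complex) \<Rightarrow> ('f \<Rightarrow> 'c \<Rightarrow> complex) \<Rightarrow>
    ('a \<Rightarrow> 'b \<Rightarrow> 'c \<Rightarrow> complex) \<Rightarrow> 'd \<Rightarrow> 'e \<Rightarrow> 'f \<Rightarrow> complex" where
  "tensor_map A B C f g h T i j k = (\<Sum>a\<in>A. \<Sum>b\<in>B. \<Sum>c\<in>C. f i a * g j b * h k c * T a b c)"

lemma tensor_rank_le_map:
  assumes "tensor_rank_le A B C T r"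
  shows "tensor_rank_le D E F (tensor_map A B C f g h T) r"
proof -
  obtain u v w where T: "\<forall>a\<in>A. \<forall>b\<in>B. \<forall>c\<in>C. T a b c = (\<Sum>l<r. u l a * v l b * w l c)"
    using assms unfolding tensor_rank_le_def by blast
  have "tensor_map A B C f g h T i j k =
      (\<Sum>l<r. (\<Sum>a\<in>A. f i a * u l a) * (\<Sum>b\<in>B. g j b * v l b) * (\<Sum>c\<in>C. h k c * w l c))" for i j k
  proof -
    have "tensor_map A B C f g h T i j k =
        (\<Sum>a\<in>A. \<Sum>b\<in>B. \<Sum>c\<in>C. \<Sum>l<r. (f i a * u l a) * (g j b * v l b) * (h k c * w l c))"
      unfolding tensor_map_def
      by (intro sum.cong refl) (use T in \<open>auto simp: sum_distrib_left mult_ac intro!: sum.cong\<close>)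
    also have "\<dots> = (\<Sum>l<r. \<Sum>a\<in>A. \<Sum>b\<in>B. \<Sum>c\<in>C. (f i a * u l a) * (g j b * v l b) * (h k c * w l c))"
      by (simp only: sum.swap[of _ "{..<r}"])
    also have "\<dots> = (\<Sum>l<r. (\<Sum>a\<in>A. f i a * u l a) * (\<Sum>b\<in>B. g j b * v l b) * (\<Sum>c\<in>C. h k c * w l c))"
      by (simp only: sum_distrib_left[symmetric] sum_distrib_right[symmetric])
    finally show ?thesis .
  qed
  then show ?thesis
    by (intro tensor_rank_leI[of "{..<r}" _ _ _ _ _ "\<lambda>l i. \<Sum>a\<in>A. f i a * u l a"
          "\<lambda>l j. \<Sum>b\<in>B. g j b * v l b" "\<lambda>l k. \<Sum>c\<in>C. h k c * w l c"]) auto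
qed

lemma border_rank_leI:
  assumes "\<forall>\<^sub>F n in sequentially. tensor_rank_le A B C (S n) r"
    and "\<And>a b c. a \<in> A \<Longrightarrow> b \<in> B \<Longrightarrow> c \<in> C \<Longrightarrow> (\<lambda>n. S n a b c) \<longlonglongrightarrow> T a b c"
  shows "border_rank_le A B C T r"
proof -
  obtain N where "\<And>n. n \<ge> N \<Longrightarrow> tensor_rank_le A B C (S n) r"
    using assms(1) unfolding eventually_sequentially by blast
  then show ?thesis
    unfolding border_rank_le_def
    by (intro exI[of _ "\<lambda>n. S (n + N)"]) (auto intro: LIMSEQ_ignore_initial_segment assms(2))
qed

lemma border_rank_le_mono:
  assumes "border_rank_le A B C T r" "r \<le> s"
  shows "border_rank_le A B C T s"
  using assms tensor_rank_le_mono unfolding border_rank_le_def by meson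

lemma border_rank_le_cong:
  assumes "border_rank_le A B C T r"
    and "\<And>a b c. a \<in> A \<Longrightarrow> b \<in> B \<Longrightarrow> c \<in> C \<Longrightarrow> T a b c = T' a b c"
  shows "border_rank_le A B C T' r"
  using assms unfolding border_rank_le_def by simp

lemma tensor_rank_le_subset:
  assumes "tensor_rank_le A B C T r" "A' \<subseteq> A"
  shows "tensor_rank_le A' B C T r"
proof -
  obtain u v w where "\<forall>a\<in>A. \<forall>b\<in>B. \<forall>c\<in>C. T a b c = (\<Sum>l<r. u l a * v l b * w l c)"
    using assms(1) unfolding tensor_rank_le_def by blast
  then show ?thesis
    using assms(2) by (intro tensor_rank_leI[of "{..<r}" r _ _ _ _ u v w]) auto
qed

lemma border_rank_le_subset:
  assumes "border_rank_le A B C T r" "A' \<subseteq> A"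
  shows "border_rank_le A' B C T r"
proof -
  obtain S where "\<And>n. tensor_rank_le A B C (S n) r"
    "\<And>a b c. a \<in> A \<Longrightarrow> b \<in> B \<Longrightarrow> c \<in> C \<Longrightarrow> (\<lambda>n. S n a b c) \<longlonglongrightarrow> T a b c"
    using assms unfolding border_rank_le_def by blast
  then show ?thesis
    unfolding border_rank_le_def
    by (intro exI[of _ S] conjI allI ballI tensor_rank_le_subset[OF _ assms(2)]) (use assms(2) in blast)+
qed

lemma tendsto_tensor_map:
  assumes f: "\<And>a. a \<in> A \<Longrightarrow> (\<lambda>n. f n i a) \<longlonglongrightarrow> f' i a"
    and S: "\<And>a b c. a \<in> A \<Longrightarrow> b \<in> B \<Longrightarrow> c \<in> C \<Longrightarrow> (\<lambda>n. S n a b c) \<longlonglongrightarrow> T a b c"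
  shows "(\<lambda>n. tensor_map A B C (f n) g h (S n) i j k) \<longlonglongrightarrow> tensor_map A B C f' g h T i j k"
proof -
  have "(\<lambda>n. f n i a * g j b * h k c * S n a b c) \<longlonglongrightarrow> f' i a * g j b * h k c * T a b c"
    if "a \<in> A" "b \<in> B" "c \<in> C" for a b c
    by (rule tendsto_mult[OF tendsto_mult_right[OF tendsto_mult_right[OF f]] S]) (use that in auto)
  then show ?thesis
    unfolding tensor_map_def by (intro tendsto_sum)
qed

lemma border_rank_le_map:
  assumes "border_rank_le A B C T r"
  shows "border_rank_le D E F (tensor_map A B C f g h T) r"
proof -
  obtain S where S: "\<And>n. tensor_rank_le A B C (S n) r"
    "\<And>a b c. a \<in> A \<Longrightarrow> b \<in> B \<Longrightarrow> c \<in> C \<Longrightarrow> (\<lambda>n. S n a b c) \<longlonglongrightarrow> T a b c"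
    using assms unfolding border_rank_le_def by blast
  show ?thesis
  proof (rule border_rank_leI[of _ _ _ "\<lambda>n. tensor_map A B C f g h (S n)"])
    show "\<forall>\<^sub>F n in sequentially. tensor_rank_le D E F (tensor_map A B C f g h (S n)) r"
      by (simp add: tensor_rank_le_map S(1))
    show "(\<lambda>n. tensor_map A B C f g h (S n) i j k) \<longlonglongrightarrow> tensor_map A B C f g h T i j k" for i j k
      by (rule tendsto_tensor_map) (auto intro: S(2))
  qed
qed

definition slice_map :: "'a set \<Rightarrow> ('d \<Rightarrow> 'a \<Rightarrow> complex) \<Rightarrow> ('a \<Rightarrow> 'b \<Rightarrow> 'c \<Rightarrow> complex) \<Rightarrow> 'd \<Rightarrow> 'b \<Rightarrow> 'c \<Rightarrow> complex" where
  "slice_map A f T i b c = (\<Sum>a\<in>A. f i a * T a b c)"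

lemma slice_map_eq_tensor_map:
  assumes "finite B" "finite C" "b \<in> B" "c \<in> C"
  shows "slice_map A f T i b c = tensor_map A B C f (\<lambda>j b. of_bool (j = b)) (\<lambda>k c. of_bool (k = c)) T i b c"
proof -
  have *: "(\<Sum>b'\<in>B. \<Sum>c'\<in>C. f i a * of_bool (b = b') * of_bool (c = c') * T a b' c') = f i a * T a b c" for a
  proof -
    have "(\<Sum>b'\<in>B. \<Sum>c'\<in>C. f i a * of_bool (b = b') * of_bool (c = c') * T a b' c') =
        (\<Sum>b'\<in>B. of_bool (b = b') * (\<Sum>c'\<in>C. of_bool (c = c') * (f i a * T a b' c')))"
      by (simp add: sum_distrib_left mult_ac)
    then show ?thesis using assms by (simp add: of_bool_def mult_delta_left)
  qed
  show ?thesis unfolding slice_map_def tensor_map_def * ..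
qed

lemma border_rank_le_slice_map:
  assumes "border_rank_le A B C T r" "finite B" "finite C"
  shows "border_rank_le D B C (slice_map A f T) r"
  using border_rank_le_map[OF assms(1), of D B C f "\<lambda>j b. of_bool (j = b)" "\<lambda>k c. of_bool (k = c)"]
  by (rule border_rank_le_cong) (use assms in \<open>auto simp: slice_map_eq_tensor_map\<close>)

text \<open>With one approximating tensor per tolerance, closedness under limits becomes an
  \<open>e / 2\<close> argument and no diagonal sequence has to be extracted.\<close>

lemma border_rank_le_iff:
  assumes "finite A" "finite B" "finite C"
  shows "border_rank_le A B C T r \<longleftrightarrow>
    (\<forall>e>0. \<exists>S. tensor_rank_le A B C S r \<and> (\<forall>a\<in>A. \<forall>b\<in>B. \<forall>c\<in>C. cmod (S a b c - T a b c) < e))"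
    (is "_ \<longleftrightarrow> ?R")
proof
  assume "border_rank_le A B C T r"
  then obtain S where S: "\<And>n. tensor_rank_le A B C (S n) r"
    "\<And>a b c. a \<in> A \<Longrightarrow> b \<in> B \<Longrightarrow> c \<in> C \<Longrightarrow> (\<lambda>n. S n a b c) \<longlonglongrightarrow> T a b c"
    unfolding border_rank_le_def by blast
  show ?R
  proof (intro allI impI)
    fix e :: real assume "e > 0"
    then have "\<forall>\<^sub>F n in sequentially. cmod (S n a b c - T a b c) < e"
      if "a \<in> A" "b \<in> B" "c \<in> C" for a b c
      using tendstoD[OF S(2)[OF that], of e] by (simp add: dist_norm)
    then have "\<forall>\<^sub>F n in sequentially. \<forall>a\<in>A. \<forall>b\<in>B. \<forall>c\<in>C. cmod (S n a b c - T a b c) < e"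
      by (intro eventually_ball_finite assms(1-3) ballI)
    then obtain n where "\<forall>a\<in>A. \<forall>b\<in>B. \<forall>c\<in>C. cmod (S n a b c - T a b c) < e"
      using eventually_happens'[OF sequentially_bot] by blast
    then show "\<exists>S. tensor_rank_le A B C S r \<and> (\<forall>a\<in>A. \<forall>b\<in>B. \<forall>c\<in>C. cmod (S a b c - T a b c) < e)"
      using S(1) by blast
  qed
next
  assume ?R
  then have "\<forall>n. \<exists>S. tensor_rank_le A B C S r \<and>
      (\<forall>a\<in>A. \<forall>b\<in>B. \<forall>c\<in>C. cmod (S a b c - T a b c) < inverse (real (Suc n)))"
    by (simp del: of_nat_Suc)
  from choice[OF this] obtain S where S: "\<And>n. tensor_rank_le A B C (S n) r"
    "\<And>n a b c. a \<in> A \<Longrightarrow> b \<in> B \<Longrightarrow> c \<in> C \<Longrightarrow> cmod (S n a b c - T a b c) < inverse (real (Suc n))"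
    by blast
  show "border_rank_le A B C T r"
  proof (rule border_rank_leI[of _ _ _ S])
    fix a b c assume "a \<in> A" "b \<in> B" "c \<in> C"
    then have "(\<lambda>n. S n a b c - T a b c) \<longlonglongrightarrow> 0"
      using S(2) by (intro Lim_null_comparison[OF always_eventually LIMSEQ_inverse_real_of_nat] allI)
        (auto intro: less_imp_le simp del: of_nat_Suc)
    then show "(\<lambda>n. S n a b c) \<longlonglongrightarrow> T a b c" by (simp add: LIM_zero_iff)
  qed (simp add: S(1))
qed

lemma border_rank_le_limit:
  assumes "finite A" "finite B" "finite C"
    and S: "\<And>n. border_rank_le A B C (S n) r"
    and lim: "\<And>a b c. a \<in> A \<Longrightarrow> b \<in> B \<Longrightarrow> c \<in> C \<Longrightarrow> (\<lambda>n. S n a b c) \<longlonglongrightarrow> T a b c"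
  shows "border_rank_le A B C T r"
  unfolding border_rank_le_iff[OF assms(1-3)]
proof (intro allI impI)
  fix e :: real assume "e > 0"
  then have "\<forall>\<^sub>F n in sequentially. cmod (S n a b c - T a b c) < e / 2"
    if "a \<in> A" "b \<in> B" "c \<in> C" for a b c
    using tendstoD[OF lim[OF that], of "e / 2"] by (simp add: dist_norm)
  then have "\<forall>\<^sub>F n in sequentially. \<forall>a\<in>A. \<forall>b\<in>B. \<forall>c\<in>C. cmod (S n a b c - T a b c) < e / 2"
    by (intro eventually_ball_finite assms(1-3) ballI)
  then obtain n where n: "\<And>a b c. a \<in> A \<Longrightarrow> b \<in> B \<Longrightarrow> c \<in> C \<Longrightarrow> cmod (S n a b c - T a b c) < e / 2"
    using eventually_happens'[OF sequentially_bot] by blast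
  obtain S' where S': "tensor_rank_le A B C S' r"
    "\<And>a b c. a \<in> A \<Longrightarrow> b \<in> B \<Longrightarrow> c \<in> C \<Longrightarrow> cmod (S' a b c - S n a b c) < e / 2"
    using S[of n, unfolded border_rank_le_iff[OF assms(1-3)], rule_format, OF half_gt_zero[OF \<open>e > 0\<close>]]
    by blast
  show "\<exists>S. tensor_rank_le A B C S r \<and> (\<forall>a\<in>A. \<forall>b\<in>B. \<forall>c\<in>C. cmod (S a b c - T a b c) < e)"
  proof (intro exI[of _ S'] conjI ballI)
    fix a b c assume "a \<in> A" "b \<in> B" "c \<in> C"
    then have "cmod (S' a b c - T a b c) < e / 2 + e / 2"
      by (intro norm_diff_triangle_less[OF S'(2) n])
    then show "cmod (S' a b c - T a b c) < e" by simp
  qed (fact S'(1))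
qed

section \<open>Border substitution\<close>

lemma finite_convergent_subsequence:
  fixes x :: "nat \<Rightarrow> 'a \<Rightarrow> complex"
  assumes "finite A" "\<And>n a. a \<in> A \<Longrightarrow> cmod (x n a) \<le> K"
  shows "\<exists>\<sigma> y. strict_mono \<sigma> \<and> (\<forall>a\<in>A. (\<lambda>n. x (\<sigma> n) a) \<longlonglongrightarrow> y a)"
  using assms
proof (induction A rule: finite_induct)
  case empty
  show ?case by (auto intro: exI[of _ id] strict_mono_id)
next
  case (insert b A)
  then obtain \<sigma> y where \<sigma>: "strict_mono \<sigma>" "\<And>a. a \<in> A \<Longrightarrow> (\<lambda>n. x (\<sigma> n) a) \<longlonglongrightarrow> y a"
    by (metis insertI2)
  have "bounded (range (\<lambda>n. x (\<sigma> n) b))"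
    using insert.prems by (auto simp: bounded_iff)
  then obtain l \<tau> where \<tau>: "strict_mono \<tau>" "((\<lambda>n. x (\<sigma> n) b) \<circ> \<tau>) \<longlonglongrightarrow> l"
    using bounded_imp_convergent_subsequence by blast
  show ?case
  proof (intro exI conjI ballI)
    show "strict_mono (\<sigma> \<circ> \<tau>)" using \<sigma>(1) \<tau>(1) by (rule strict_mono_o)
    fix a assume "a \<in> insert b A"
    then show "(\<lambda>n. x ((\<sigma> \<circ> \<tau>) n) a) \<longlonglongrightarrow> (y(b := l)) a"
      using \<tau> LIMSEQ_subseq_LIMSEQ[OF \<sigma>(2) \<tau>(1)] insert.hyps by (auto simp: o_def)
  qed
qed

lemma tensor_rank_le_slice_map:
  assumes "tensor_rank_le A B C T r"
  shows "tensor_rank_le D B C (slice_map A f T) r"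
proof -
  obtain u v w where T: "\<forall>a\<in>A. \<forall>b\<in>B. \<forall>c\<in>C. T a b c = (\<Sum>l<r. u l a * v l b * w l c)"
    using assms unfolding tensor_rank_le_def by blast
  show ?thesis
  proof (rule tensor_rank_leI[of "{..<r}"])
    fix i b c assume "b \<in> B" "c \<in> C"
    then have "slice_map A f T i b c = (\<Sum>a\<in>A. \<Sum>l<r. f i a * u l a * v l b * w l c)"
      unfolding slice_map_def by (intro sum.cong refl) (use T in \<open>auto simp: sum_distrib_left mult.assoc\<close>)
    also have "\<dots> = (\<Sum>l<r. (\<Sum>a\<in>A. f i a * u l a) * v l b * w l c)"
      by (subst sum.swap) (simp add: sum_distrib_right)
    finally show "slice_map A f T i b c = (\<Sum>l<r. (\<Sum>a\<in>A. f i a * u l a) * v l b * w l c)" .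
  qed auto
qed

text \<open>A nonzero entry forces some summand to have a nonzero first vector. Normalising this
  vector, with its scale moved into \<open>M\<close>, keeps its later limit away from zero.\<close>

lemma tensor_rank_le_split:
  assumes "tensor_rank_le A B C T (Suc r)" "finite A"
    and nz: "a0 \<in> A" "b0 \<in> B" "c0 \<in> C" "T a0 b0 c0 \<noteq> 0"
  shows "\<exists>x M. (\<Sum>a\<in>A. cmod (x a)) = 1 \<and> tensor_rank_le A B C (\<lambda>a b c. T a b c - x a * M b c) r"
proof -
  obtain u v w where T: "\<And>a b c. a \<in> A \<Longrightarrow> b \<in> B \<Longrightarrow> c \<in> C \<Longrightarrow> T a b c = (\<Sum>l<Suc r. u l a * v l b * w l c)"
    using assms(1) unfolding tensor_rank_le_def by blast
  have "\<exists>l<Suc r. u l a0 \<noteq> 0"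
    using nz(4) unfolding T[OF nz(1-3)] by (metis (no_types, lifting) lessThan_iff mult_zero_left sum.neutral)
  then obtain l where l: "l < Suc r" "u l a0 \<noteq> 0" by blast
  define s where "s = (\<Sum>a\<in>A. cmod (u l a))"
  have "s > 0"
    unfolding s_def using nz(1) l(2) \<open>finite A\<close> by (intro sum_pos2[of _ a0]) auto
  define x where "x = (\<lambda>a. u l a / of_real s)"
  have "(\<Sum>a\<in>A. cmod (x a)) = (\<Sum>a\<in>A. cmod (u l a) / s)"
    using \<open>s > 0\<close> by (simp add: x_def norm_divide)
  then have 1: "(\<Sum>a\<in>A. cmod (x a)) = 1"
    using \<open>s > 0\<close> by (simp add: flip: sum_divide_distrib s_def)
  have 2: "tensor_rank_le A B C (\<lambda>a b c. T a b c - x a * (of_real s * v l b * w l c)) r"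
  proof (rule tensor_rank_leI[of "{..<Suc r} - {l}"])
    fix a b c assume abc: "a \<in> A" "b \<in> B" "c \<in> C"
    show "T a b c - x a * (of_real s * v l b * w l c) = (\<Sum>l\<in>{..<Suc r} - {l}. u l a * v l b * w l c)"
      unfolding T[OF abc] using l(1) \<open>s > 0\<close>
      by (subst sum.remove[of _ l]) (auto simp: x_def)
  qed (use l in auto)
  show ?thesis
    by (rule exI[of _ x], rule exI[of _ "\<lambda>b c. of_real s * v l b * w l c"]) (intro conjI 1 2)
qed

text \<open>One rank-one summand of the approximating tensors, normalised and followed along a convergent
  subsequence, is killed by a perturbation of any slice map that kills its limit \<open>u\<close>.\<close>

lemma border_substitution:
  fixes T :: "'a \<Rightarrow> 'b \<Rightarrow> 'c \<Rightarrow> complex"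
  assumes br: "border_rank_le A B C T (Suc r)" and "finite A"
    and nz: "a0 \<in> A" "b0 \<in> B" "c0 \<in> C" "T a0 b0 c0 \<noteq> 0"
  shows "\<exists>u. (\<exists>a\<in>A. u a \<noteq> 0) \<and>
    (\<forall>D (f :: 'd \<Rightarrow> 'a \<Rightarrow> complex). (\<forall>i\<in>D. (\<Sum>a\<in>A. f i a * u a) = 0) \<longrightarrow>
      border_rank_le D B C (slice_map A f T) r)"
proof -
  obtain S0 where S0: "\<And>n. tensor_rank_le A B C (S0 n) (Suc r)"
    "\<And>a b c. a \<in> A \<Longrightarrow> b \<in> B \<Longrightarrow> c \<in> C \<Longrightarrow> (\<lambda>n. S0 n a b c) \<longlonglongrightarrow> T a b c"
    using br unfolding border_rank_le_def by blast
  obtain N where N: "\<And>n. n \<ge> N \<Longrightarrow> S0 n a0 b0 c0 \<noteq> 0"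
    using tendsto_imp_eventually_ne[OF S0(2)[OF nz(1-3)] nz(4)] unfolding eventually_sequentially by blast
  have "\<forall>n. \<exists>x M. (\<Sum>a\<in>A. cmod (x a)) = 1 \<and>
      tensor_rank_le A B C (\<lambda>a b c. S0 (n + N) a b c - x a * M b c) r"
    using tensor_rank_le_split[OF S0(1) \<open>finite A\<close> nz(1-3)] N by simp
  from choice[OF this] obtain x where xM: "\<forall>n. \<exists>M. (\<Sum>a\<in>A. cmod (x n a)) = 1 \<and>
      tensor_rank_le A B C (\<lambda>a b c. S0 (n + N) a b c - x n a * M b c) r"
    by blast
  from choice[OF this] obtain M where x: "\<And>n. (\<Sum>a\<in>A. cmod (x n a)) = 1"
    and M: "\<And>n. tensor_rank_le A B C (\<lambda>a b c. S0 (n + N) a b c - x n a * M n b c) r"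
    by blast
  have "cmod (x n a) \<le> 1" if "a \<in> A" for n a
    using member_le_sum[OF that, of "\<lambda>a. cmod (x n a)"] \<open>finite A\<close> x[of n] by simp
  then obtain \<sigma> u where \<sigma>: "strict_mono \<sigma>" "\<And>a. a \<in> A \<Longrightarrow> (\<lambda>n. x (\<sigma> n) a) \<longlonglongrightarrow> u a"
    using finite_convergent_subsequence[OF \<open>finite A\<close>, of x 1] by blast
  have "(\<lambda>n. \<Sum>a\<in>A. cmod (x (\<sigma> n) a)) \<longlonglongrightarrow> (\<Sum>a\<in>A. cmod (u a))"
    by (intro tendsto_sum tendsto_norm \<sigma>(2))
  then have "(\<Sum>a\<in>A. cmod (u a)) = 1"
    using x by (simp add: LIMSEQ_const_iff)
  then have "\<exists>a\<in>A. u a \<noteq> 0"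
    by (metis (no_types, lifting) norm_zero sum.neutral zero_neq_one)
  then obtain p where p: "p \<in> A" "u p \<noteq> 0" by blast
  define S where "S n = S0 (\<sigma> n + N)" for n
  have lim: "(\<lambda>n. S n a b c) \<longlonglongrightarrow> T a b c" if "a \<in> A" "b \<in> B" "c \<in> C" for a b c
    using LIMSEQ_subseq_LIMSEQ[OF LIMSEQ_ignore_initial_segment[OF S0(2)[OF that], of N] \<sigma>(1)]
    by (simp add: S_def o_def)
  have "border_rank_le D B C (slice_map A f T) r"
    if f: "\<forall>i\<in>D. (\<Sum>a\<in>A. f i a * u a) = 0" for D and f :: "'d \<Rightarrow> 'a \<Rightarrow> complex"
  proof -
    \<comment> \<open>Only the coordinate \<open>p\<close>, where the limit does not vanish, is
      corrected: \<open>g n\<close> kills \<open>x (\<sigma> n)\<close> exactly, and the correction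
      tends to \<open>(\<Sum>a\<in>A. f i a * u a) / u p = 0\<close>.\<close>
    define g where "g n i a = f i a - (if a = p then (\<Sum>a\<in>A. f i a * x (\<sigma> n) a) / x (\<sigma> n) p else 0)" for n i a
    have g_lim: "(\<lambda>n. g n i a) \<longlonglongrightarrow> f i a" if "i \<in> D" for i a
    proof -
      have "(\<lambda>n. (\<Sum>a\<in>A. f i a * x (\<sigma> n) a) / x (\<sigma> n) p) \<longlonglongrightarrow> (\<Sum>a\<in>A. f i a * u a) / u p"
        by (intro tendsto_divide tendsto_sum tendsto_mult_left \<sigma>(2) p)
      then have "(\<lambda>n. f i a - (\<Sum>a\<in>A. f i a * x (\<sigma> n) a) / x (\<sigma> n) p) \<longlonglongrightarrow> f i a - 0"
        using f that by (intro tendsto_diff tendsto_const) simp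
      then show ?thesis by (cases "a = p") (simp_all add: g_def)
    qed
    have "\<forall>\<^sub>F n in sequentially. x (\<sigma> n) p \<noteq> 0"
      using tendsto_imp_eventually_ne[OF \<sigma>(2)] p by blast
    then have "\<forall>\<^sub>F n in sequentially. tensor_rank_le D B C (slice_map A (g n) (S n)) r"
    proof eventually_elim
      case (elim n)
      have "(\<Sum>a\<in>A. g n i a * x (\<sigma> n) a) = 0" for i
      proof -
        have "(\<Sum>a\<in>A. g n i a * x (\<sigma> n) a) = (\<Sum>a\<in>A. f i a * x (\<sigma> n) a)
            - (\<Sum>a\<in>A. if a = p then \<Sum>a\<in>A. f i a * x (\<sigma> n) a else 0)"
          unfolding sum_subtractf[symmetric] using elim by (intro sum.cong) (auto simp: g_def algebra_simps)
        then show ?thesis using p(1) \<open>finite A\<close> by simp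
      qed
      then have *: "(\<Sum>a\<in>A. g n i a * x (\<sigma> n) a * m) = 0" for i m
        by (simp flip: sum_distrib_right)
      have "slice_map A (g n) (\<lambda>a b c. S n a b c - x (\<sigma> n) a * M (\<sigma> n) b c) = slice_map A (g n) (S n)"
        by (intro ext) (simp add: slice_map_def right_diff_distrib sum_subtractf * flip: mult.assoc)
      then show ?case
        using tensor_rank_le_slice_map[OF M, of D "g n" "\<sigma> n"] by (simp add: S_def)
    qed
    then show ?thesis
    proof (rule border_rank_leI)
      fix i b c assume "i \<in> D" "b \<in> B" "c \<in> C"
      then show "(\<lambda>n. slice_map A (g n) (S n) i b c) \<longlonglongrightarrow> slice_map A f T i b c"
        unfolding slice_map_def by (intro tendsto_sum tendsto_mult g_lim lim)
    qed
  qed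
  then show ?thesis using p by blast
qed

section \<open>The bracket tensor of a bilinear form\<close>

text \<open>\<open>f\<^sub>a\<close> pairs only with \<open>f\<^sub>4\<^sub>-\<^sub>a\<close>, so a
  maximal torus acts diagonally. The type is polymorphic because the same entries are computed over
  the integers and used over the complex numbers.\<close>

definition split_form :: "nat \<Rightarrow> nat \<Rightarrow> 'a::comm_ring_1" where
  "split_form a b = (if a + b = 4 then 1 else 0)"

text \<open>For a basis \<open>f\<close> with Gram matrix \<open>F\<close>, this is the inner product of \<open>[f\<^sub>a \<and> f\<^sub>b, f\<^sub>c \<and> f\<^sub>d]\<close> with
  \<open>f\<^sub>e \<and> f\<^sub>f\<close>; lowering the third index makes the tensor covariant in all three factors.\<close>

fun bracket_form :: "(nat \<Rightarrow> nat \<Rightarrow> 'a::comm_ring_1) \<Rightarrow> nat \<times> nat \<Rightarrow> nat \<times> nat \<Rightarrow> nat \<times> nat \<Rightarrow> 'a" where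
  "bracket_form F (a, b) (c, d) (e, f) =
     F b c * (F a e * F d f - F a f * F d e) - F a c * (F b e * F d f - F b f * F d e)
   - F b d * (F a e * F c f - F a f * F c e) + F a d * (F b e * F c f - F b f * F c e)"

fun compound :: "(nat \<Rightarrow> nat \<Rightarrow> complex) \<Rightarrow> nat \<times> nat \<Rightarrow> nat \<times> nat \<Rightarrow> complex" where
  "compound P (a, b) (c, d) = P a c * P b d - P a d * P b c"

lemma so5_index_eq:
  "so5_index = {(0,1),(0,2),(0,3),(0,4),(1,2),(1,3),(1,4),(2,3),(2,4),(3,4)}"
proof (rule Set.set_eqI)
  fix p :: "nat \<times> nat"
  obtain a b where p: "p = (a, b)" by (cases p)
  have "a < b \<and> b < 5 \<longleftrightarrow> a = 0 \<and> b = 1 \<or> a = 0 \<and> b = 2 \<or> a = 0 \<and> b = 3 \<or> a = 0 \<and> b = 4 \<or> a = 1 \<and> b = 2 \<or>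
      a = 1 \<and> b = 3 \<or> a = 1 \<and> b = 4 \<or> a = 2 \<and> b = 3 \<or> a = 2 \<and> b = 4 \<or> a = 3 \<and> b = 4"
    by presburger
  then show "p \<in> so5_index \<longleftrightarrow> p \<in> {(0,1),(0,2),(0,3),(0,4),(1,2),(1,3),(1,4),(2,3),(2,4),(3,4)}"
    by (simp add: p so5_index_def)
qed

lemma finite_so5_index [simp]: "finite so5_index"
  by (simp add: so5_index_eq)

lemma lessThan_5: "{..<5::nat} = {0, 1, 2, 3, 4}"
  by auto

text \<open>Antisymmetry turns a sum of 2 by 2 minors over increasing pairs into a free double sum,
  which can then be factored index by index.\<close>

lemma sum_compound:
  assumes "\<And>c d. g (d, c) = - g (c, d)"
  shows "(\<Sum>q\<in>so5_index. compound P (a, b) q * g q) = (\<Sum>c<5. \<Sum>d<5. P a c * P b d * g (c, d))"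
proof -
  have diag: "g (c, c) = 0" for c
    using assms[of c c] by simp
  show ?thesis
    by (simp add: so5_index_eq lessThan_5 diag assms[of _ 0] assms[of 2 "Suc 0"] assms[of 3 "Suc 0"] assms[of 4 "Suc 0"]
        assms[of 3 2] assms[of 4 2] assms[of 4 3] algebra_simps)
qed

text \<open>Three independent Gram matrices, so that the base change can be applied to one factor at a time.\<close>

fun mixed_form :: "(nat \<Rightarrow> nat \<Rightarrow> complex) \<Rightarrow> (nat \<Rightarrow> nat \<Rightarrow> complex) \<Rightarrow> (nat \<Rightarrow> nat \<Rightarrow> complex) \<Rightarrow>
    nat \<times> nat \<Rightarrow> nat \<times> nat \<Rightarrow> nat \<times> nat \<Rightarrow> complex" where
  "mixed_form F G H (a, b) (c, d) (e, f) =
     F b c * (G a e * H d f - G a f * H d e) - F a c * (G b e * H d f - G b f * H d e)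
   - F b d * (G a e * H c f - G a f * H c e) + F a d * (G b e * H c f - G b f * H c e)"

lemma double_sum_product:
  fixes p q :: "nat \<Rightarrow> complex"
  shows "(\<Sum>c<5. \<Sum>d<5. p c * q d * (x c * y d)) = (\<Sum>c<5. p c * x c) * (\<Sum>d<5. q d * y d)"
  unfolding sum_product by (simp add: mult_ac)

lemma double_sum_lin:
  fixes p q :: "nat \<Rightarrow> complex"
  shows "(\<Sum>c<5. \<Sum>d<5. p c * q d * (x c d + y c d)) =
      (\<Sum>c<5. \<Sum>d<5. p c * q d * x c d) + (\<Sum>c<5. \<Sum>d<5. p c * q d * y c d)"
    "(\<Sum>c<5. \<Sum>d<5. p c * q d * (x c d - y c d)) =
      (\<Sum>c<5. \<Sum>d<5. p c * q d * x c d) - (\<Sum>c<5. \<Sum>d<5. p c * q d * y c d)"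
    "(\<Sum>c<5. \<Sum>d<5. p c * q d * (k * x c d)) = k * (\<Sum>c<5. \<Sum>d<5. p c * q d * x c d)"
  by (simp_all add: sum.distrib sum_subtractf distrib_left right_diff_distrib sum_distrib_left mult_ac)

text \<open>\<open>F\<close> joins the first factor to the second, \<open>G\<close> the first to the
  third, \<open>H\<close> the second to the third; a base change in one factor therefore alters
  exactly two of them. The products are first reordered as \<open>double_sum_product\<close>
  expects, the first summation index in front.\<close>

lemma mixed_form_step3:
  "(\<Sum>e'<5. \<Sum>f'<5. P e e' * P f f' * mixed_form F G H (a, b) (c, d) (e', f')) =
   mixed_form F (\<lambda>x e. \<Sum>i<5. P e i * G x i) (\<lambda>x e. \<Sum>i<5. P e i * H x i) (a, b) (c, d) (e, f)"
proof -
  have "(\<Sum>e'<5. \<Sum>f'<5. P e e' * P f f' * mixed_form F G H (a, b) (c, d) (e', f')) =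
    (\<Sum>e'<5. \<Sum>f'<5. P e e' * P f f' * (F b c * (G a e' * H d f' - H d e' * G a f') - F a c * (G b e' * H d f' - H d e' * G b f')
   - F b d * (G a e' * H c f' - H c e' * G a f') + F a d * (G b e' * H c f' - H c e' * G b f')))"
    by (simp add: mult.commute)
  also have "\<dots> = mixed_form F (\<lambda>x e. \<Sum>i<5. P e i * G x i) (\<lambda>x e. \<Sum>i<5. P e i * H x i) (a, b) (c, d) (e, f)"
    by (simp only: double_sum_lin double_sum_product mixed_form.simps) (simp add: mult.commute)
  finally show ?thesis .
qed

lemma mixed_form_step2:
  "(\<Sum>c'<5. \<Sum>d'<5. P c c' * P d d' * mixed_form F G H (a, b) (c', d') (e, f)) =
   mixed_form (\<lambda>x c. \<Sum>i<5. P c i * F x i) G (\<lambda>d x. \<Sum>i<5. P d i * H i x) (a, b) (c, d) (e, f)"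
proof -
  have "(\<Sum>c'<5. \<Sum>d'<5. P c c' * P d d' * mixed_form F G H (a, b) (c', d') (e, f)) =
    (\<Sum>c'<5. \<Sum>d'<5. P c c' * P d d' * ((G a e * (F b c' * H d' f) - G a f * (F b c' * H d' e))
    - (G b e * (F a c' * H d' f) - G b f * (F a c' * H d' e))
   - (G a e * (H c' f * F b d') - G a f * (H c' e * F b d')) + (G b e * (H c' f * F a d') - G b f * (H c' e * F a d'))))"
    by (intro sum.cong refl arg_cong2[of _ _ _ _ "(*)"]) (simp add: algebra_simps)
  also have "\<dots> = mixed_form (\<lambda>x c. \<Sum>i<5. P c i * F x i) G (\<lambda>d x. \<Sum>i<5. P d i * H i x) (a, b) (c, d) (e, f)"
    by (simp only: double_sum_lin double_sum_product mixed_form.simps) (simp add: algebra_simps)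
  finally show ?thesis .
qed

lemma mixed_form_step1:
  "(\<Sum>a'<5. \<Sum>b'<5. P a a' * P b b' * mixed_form F G H (a', b') (c, d) (e, f)) =
   mixed_form (\<lambda>b x. \<Sum>i<5. P b i * F i x) (\<lambda>b x. \<Sum>i<5. P b i * G i x) H (a, b) (c, d) (e, f)"
proof -
  have "(\<Sum>a'<5. \<Sum>b'<5. P a a' * P b b' * mixed_form F G H (a', b') (c, d) (e, f)) =
    (\<Sum>a'<5. \<Sum>b'<5. P a a' * P b b' * ((H d f * (G a' e * F b' c) - H d e * (G a' f * F b' c))
    - (H d f * (F a' c * G b' e) - H d e * (F a' c * G b' f))
   - (H c f * (G a' e * F b' d) - H c e * (G a' f * F b' d)) + (H c f * (F a' d * G b' e) - H c e * (F a' d * G b' f))))"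
    by (intro sum.cong refl arg_cong2[of _ _ _ _ "(*)"]) (simp add: algebra_simps)
  also have "\<dots> = mixed_form (\<lambda>b x. \<Sum>i<5. P b i * F i x) (\<lambda>b x. \<Sum>i<5. P b i * G i x) H (a, b) (c, d) (e, f)"
    by (simp only: double_sum_lin double_sum_product mixed_form.simps) (simp add: algebra_simps)
  finally show ?thesis .
qed

lemma mixed_form_antisym:
  "mixed_form F G H (b, a) q k = - mixed_form F G H (a, b) q k"
  "mixed_form F G H p (d, c) k = - mixed_form F G H p (c, d) k"
  "mixed_form F G H p q (f, e) = - mixed_form F G H p q (e, f)"
  by (cases p; cases q; cases k; simp add: algebra_simps)+

lemma bracket_form_eq_mixed: "bracket_form F p q k = mixed_form F F F p q k"
  by (cases p; cases q; cases k) simp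

text \<open>The exterior square of \<open>P\<close> carries the bracket tensor of the form \<open>F\<close> to that of \<open>P F P\<^sup>T\<close>; this covers
  both the change to an isotropic basis and the invariance under isometries.\<close>

lemma tensor_map_compound:
  assumes F': "\<And>a b. a < 5 \<Longrightarrow> b < 5 \<Longrightarrow> (\<Sum>c<5. P a c * (\<Sum>d<5. P b d * F c d)) = F' a b"
    and "p \<in> so5_index" "q \<in> so5_index" "k \<in> so5_index"
  shows "tensor_map so5_index so5_index so5_index (compound P) (compound P) (compound P) (bracket_form F) p q k
    = bracket_form F' p q k"
proof -
  obtain a b c d e f where pqk: "p = (a, b)" "q = (c, d)" "k = (e, f)"
    by (cases p; cases q; cases k) blast
  have lt: "a < 5" "b < 5" "c < 5" "d < 5" "e < 5" "f < 5"
    using assms(2-4) unfolding pqk so5_index_def by auto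
  let ?R = "\<lambda>x e. \<Sum>i<5. P e i * F x i"
  let ?L = "\<lambda>G d x. \<Sum>i<5. P d i * G i x"
  have "tensor_map so5_index so5_index so5_index (compound P) (compound P) (compound P) (bracket_form F) p q k
    = (\<Sum>p'\<in>so5_index. compound P p p' * (\<Sum>q'\<in>so5_index. compound P q q' *
        (\<Sum>k'\<in>so5_index. compound P k k' * mixed_form F F F p' q' k')))"
    unfolding tensor_map_def bracket_form_eq_mixed by (simp add: sum_distrib_left mult_ac)
  also have "\<dots> = (\<Sum>p'\<in>so5_index. compound P p p' * (\<Sum>q'\<in>so5_index. compound P q q' *
        mixed_form F ?R ?R p' q' k))"
  proof (intro sum.cong refl arg_cong2[of _ _ _ _ "(*)"])
    fix p' q'
    show "(\<Sum>k'\<in>so5_index. compound P k k' * mixed_form F F F p' q' k') = mixed_form F ?R ?R p' q' k"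
      unfolding pqk by (cases p'; cases q') (simp only: sum_compound[where g = "mixed_form F F F _ _", OF mixed_form_antisym(3)] mixed_form_step3)
  qed
  also have "\<dots> = (\<Sum>p'\<in>so5_index. compound P p p' * mixed_form ?R ?R (?L ?R) p' q k)"
  proof (intro sum.cong refl arg_cong2[of _ _ _ _ "(*)"])
    fix p'
    show "(\<Sum>q'\<in>so5_index. compound P q q' * mixed_form F ?R ?R p' q' k) = mixed_form ?R ?R (?L ?R) p' q k"
      unfolding pqk by (cases p') (simp only: sum_compound[where g = "\<lambda>q'. mixed_form F ?R ?R _ q' (e, f)", OF mixed_form_antisym(2)] mixed_form_step2)
  qed
  also have "\<dots> = mixed_form (?L ?R) (?L ?R) (?L ?R) p q k"
    unfolding pqk by (simp only: sum_compound[where g = "\<lambda>p'. mixed_form ?R ?R (?L ?R) p' (c, d) (e, f)", OF mixed_form_antisym(1)] mixed_form_step1)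
  also have "\<dots> = bracket_form F' p q k"
    unfolding pqk by (simp only: mixed_form.simps bracket_form.simps F' lt)
  finally show ?thesis .
qed

section \<open>The commutator of skew-symmetric matrices in coordinates\<close>

lemma so5_basis_eq:
  "a < b \<Longrightarrow> so5_basis (a, b) r s = of_bool (r = a) * of_bool (s = b) - of_bool (r = b) * of_bool (s = a)"
  by (auto simp: so5_basis_def)

text \<open>In an orthonormal basis lowering the third index changes no coordinate, and
  \<open>E_ij - E_ji\<close> corresponds to the wedge of the basis vectors \<open>i\<close> and
  \<open>j\<close>.\<close>

lemma T_so5_eq:
  assumes "p \<in> so5_index" "q \<in> so5_index" "k \<in> so5_index"
  shows "T_so5 p q k = bracket_form (\<lambda>a b. of_bool (a = b)) p q k"
proof -
  obtain a b c d e f where pqk: "p = (a, b)" "q = (c, d)" "k = (e, f)"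
    by (cases p; cases q; cases k) blast
  have lt: "a < b" "c < d" "a < 5" "b < 5" "c < 5" "d < 5"
    using assms unfolding pqk so5_index_def by auto
  have delta: "(\<Sum>m<5. of_bool (m = x) * of_bool (m = y)) = (of_bool (x = y) :: complex)" if "x < 5" for x y :: nat
    using that by (simp add: of_bool_def mult_delta_left)
  have prod: "mat_mult5 (so5_basis (a, b)) (so5_basis (c, d)) e f =
      of_bool (b = c) * (of_bool (a = e) * of_bool (d = f)) - of_bool (b = d) * (of_bool (a = e) * of_bool (c = f))
    - of_bool (a = c) * (of_bool (b = e) * of_bool (d = f)) + of_bool (a = d) * (of_bool (b = e) * of_bool (c = f))"
    if "a < b" "c < d" "a < 5" "b < 5" for a b c d
  proof -
    have "mat_mult5 (so5_basis (a, b)) (so5_basis (c, d)) e f =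
      (\<Sum>m<5. of_bool (a = e) * of_bool (d = f) * (of_bool (m = b) * of_bool (m = c))
           - of_bool (a = e) * of_bool (c = f) * (of_bool (m = b) * of_bool (m = d))
           - of_bool (b = e) * of_bool (d = f) * (of_bool (m = a) * of_bool (m = c))
           + of_bool (b = e) * of_bool (c = f) * (of_bool (m = a) * of_bool (m = d)))"
      unfolding mat_mult5_def so5_basis_eq[OF that(1)] so5_basis_eq[OF that(2)]
      by (intro sum.cong refl) (simp add: algebra_simps eq_commute)
    then show ?thesis
      by (simp only: sum.distrib sum_subtractf delta that flip: sum_distrib_left) (simp add: mult_ac)
  qed
  show ?thesis
    unfolding pqk T_so5_def bracket5_def fst_conv snd_conv prod[OF lt(1,2,3,4)] prod[OF lt(2,1,5,6)] bracket_form.simps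
    by (simp add: algebra_simps eq_commute)
qed

section \<open>Reduction to the highest weight vectors\<close>

abbreviation bracket_tensor :: "nat \<times> nat \<Rightarrow> nat \<times> nat \<Rightarrow> nat \<times> nat \<Rightarrow> complex" where
  "bracket_tensor \<equiv> bracket_form split_form"

text \<open>Row \<open>a\<close> is \<open>f\<^sub>a\<close> in orthonormal coordinates:
  \<open>e\<^sub>0 + \<i> e\<^sub>4\<close>, \<open>e\<^sub>1 + \<i> e\<^sub>3\<close>,
  \<open>e\<^sub>2\<close> and the conjugates of the first two, halved so that dual vectors pair to
  1.\<close>

definition isotropic_basis :: "nat \<Rightarrow> nat \<Rightarrow> complex" where
  "isotropic_basis a c =
    (if a = 0 then (if c = 0 then 1 else if c = 4 then \<i> else 0)
     else if a = 1 then (if c = 1 then 1 else if c = 3 then \<i> else 0)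
     else if a = 2 then (if c = 2 then 1 else 0)
     else if a = 3 then (if c = 1 then 1/2 else if c = 3 then - \<i> / 2 else 0)
     else (if c = 0 then 1/2 else if c = 4 then - \<i> / 2 else 0))"

lemma less_5_cases: "(a::nat) < 5 \<Longrightarrow> a = 0 \<or> a = 1 \<or> a = 2 \<or> a = 3 \<or> a = 4"
  by presburger

lemma isotropic_basis_form:
  assumes "a < 5" "b < 5"
  shows "(\<Sum>c<5. isotropic_basis a c * (\<Sum>d<5. isotropic_basis b d * of_bool (c = d))) = split_form a b"
  using less_5_cases[OF assms(1)] less_5_cases[OF assms(2)]
  by (elim disjE) (simp_all add: isotropic_basis_def lessThan_5 split_form_def)

lemma border_rank_le_bracket_tensor:
  assumes "border_rank_le so5_index so5_index so5_index T_so5 r"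
  shows "border_rank_le so5_index so5_index so5_index bracket_tensor r"
proof -
  have "border_rank_le so5_index so5_index so5_index (bracket_form (\<lambda>a b. of_bool (a = b))) r"
    using assms by (rule border_rank_le_cong) (rule T_so5_eq)
  from border_rank_le_map[OF this, of so5_index so5_index so5_index
      "compound isotropic_basis" "compound isotropic_basis" "compound isotropic_basis"]
  show ?thesis
    by (rule border_rank_le_cong) (rule tensor_map_compound[OF isotropic_basis_form])
qed

text \<open>\<open>killed_rank_le Z u r\<close>: modulo the coordinate vectors in \<open>Z\<close> and the vector \<open>u\<close>, the first factor of the
  bracket tensor has border rank at most \<open>r\<close>.\<close>

definition killed_rank_le :: "(nat \<times> nat) set \<Rightarrow> (nat \<times> nat \<Rightarrow> complex) \<Rightarrow> nat \<Rightarrow> bool" where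
  "killed_rank_le Z u r \<longleftrightarrow>
     (\<forall>f :: nat \<times> nat \<Rightarrow> nat \<times> nat \<Rightarrow> complex.
        (\<forall>i\<in>so5_index. (\<Sum>a\<in>so5_index - Z. f i a * u a) = 0) \<longrightarrow>
        border_rank_le so5_index so5_index so5_index (slice_map (so5_index - Z) f bracket_tensor) r)"

lemma killed_rank_le_scale:
  assumes "killed_rank_le Z u r" "c \<noteq> 0"
  shows "killed_rank_le Z (\<lambda>a. c * u a) r"
  unfolding killed_rank_le_def
proof (intro allI impI)
  fix f :: "nat \<times> nat \<Rightarrow> nat \<times> nat \<Rightarrow> complex"
  assume *: "\<forall>i\<in>so5_index. (\<Sum>a\<in>so5_index - Z. f i a * (c * u a)) = 0"
  have "(\<Sum>a\<in>so5_index - Z. f i a * (c * u a)) = c * (\<Sum>a\<in>so5_index - Z. f i a * u a)" for i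
    by (simp add: sum_distrib_left mult_ac)
  then have "\<forall>i\<in>so5_index. (\<Sum>a\<in>so5_index - Z. f i a * u a) = 0"
    using * \<open>c \<noteq> 0\<close> by simp
  then show "border_rank_le so5_index so5_index so5_index (slice_map (so5_index - Z) f bracket_tensor) r"
    using assms(1) unfolding killed_rank_le_def by blast
qed

lemma killed_rank_le_cong:
  assumes "killed_rank_le Z u r" "\<And>a. a \<in> so5_index - Z \<Longrightarrow> u a = v a"
  shows "killed_rank_le Z v r"
proof -
  have "(\<Sum>a\<in>so5_index - Z. f i a * u a) = (\<Sum>a\<in>so5_index - Z. f i a * v a)" for f :: "nat \<times> nat \<Rightarrow> nat \<times> nat \<Rightarrow> complex" and i
    using assms(2) by (intro sum.cong) auto
  then show ?thesis using assms(1) unfolding killed_rank_le_def by simp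
qed

text \<open>The killable directions form a closed set away from zero. A map killing \<open>u\<close>
  is corrected at the coordinate \<open>p\<close>, as in \<open>border_substitution\<close>, until
  it kills \<open>x n\<close>; the tensors so obtained converge, and bounded border rank is a closed
  condition.\<close>

lemma killed_rank_le_limit:
  assumes x: "\<And>n. killed_rank_le Z (x n) r" and "p \<in> so5_index - Z" "u p \<noteq> 0"
    and lim: "\<And>a. a \<in> so5_index - Z \<Longrightarrow> (\<lambda>n. x n a) \<longlonglongrightarrow> u a"
  shows "killed_rank_le Z u r"
  unfolding killed_rank_le_def
proof (intro allI impI)
  fix f :: "nat \<times> nat \<Rightarrow> nat \<times> nat \<Rightarrow> complex"
  let ?A = "so5_index - Z"
  assume f: "\<forall>i\<in>so5_index. (\<Sum>a\<in>?A. f i a * u a) = 0"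
  obtain N where N: "\<And>n. n \<ge> N \<Longrightarrow> x n p \<noteq> 0"
    using tendsto_imp_eventually_ne[OF lim[OF assms(2)] assms(3)] unfolding eventually_sequentially by blast
  define g where "g n i a = f i a - (if a = p then (\<Sum>a\<in>?A. f i a * x (n + N) a) / x (n + N) p else 0)" for n i a
  have lim': "(\<lambda>n. x (n + N) a) \<longlonglongrightarrow> u a" if "a \<in> ?A" for a
    using LIMSEQ_ignore_initial_segment[OF lim[OF that]] .
  have g_lim: "(\<lambda>n. g n i a) \<longlonglongrightarrow> f i a" if "i \<in> so5_index" for i a
  proof -
    have "(\<lambda>n. (\<Sum>a\<in>?A. f i a * x (n + N) a) / x (n + N) p) \<longlonglongrightarrow> (\<Sum>a\<in>?A. f i a * u a) / u p"
      by (intro tendsto_divide tendsto_sum tendsto_mult_left lim' assms)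
    then have "(\<lambda>n. f i a - (\<Sum>a\<in>?A. f i a * x (n + N) a) / x (n + N) p) \<longlonglongrightarrow> f i a - 0"
      using f that by (intro tendsto_diff tendsto_const) simp
    then show ?thesis by (cases "a = p") (simp_all add: g_def)
  qed
  have kill: "(\<Sum>a\<in>?A. g n i a * x (n + N) a) = 0" for n i
  proof -
    have "(\<Sum>a\<in>?A. g n i a * x (n + N) a) = (\<Sum>a\<in>?A. f i a * x (n + N) a)
        - (\<Sum>a\<in>?A. if a = p then \<Sum>a\<in>?A. f i a * x (n + N) a else 0)"
      unfolding sum_subtractf[symmetric] using N[of "n + N"]
      by (intro sum.cong) (auto simp: g_def algebra_simps)
    then show ?thesis using assms(2) by simp
  qed
  show "border_rank_le so5_index so5_index so5_index (slice_map ?A f bracket_tensor) r"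
  proof (rule border_rank_le_limit[where S = "\<lambda>n. slice_map ?A (g n) bracket_tensor"])
    show "border_rank_le so5_index so5_index so5_index (slice_map ?A (g n) bracket_tensor) r" for n
      using x[of "n + N"] kill[of n] unfolding killed_rank_le_def by blast
    fix i b c assume "i \<in> so5_index"
    then show "(\<lambda>n. slice_map ?A (g n) bracket_tensor i b c) \<longlonglongrightarrow> slice_map ?A f bracket_tensor i b c"
      unfolding slice_map_def by (intro tendsto_sum tendsto_mult_right g_lim)
  qed auto
qed

lemma border_rank_le_map23:
  assumes "border_rank_le A B C T r" "finite A"
  shows "border_rank_le A E F (\<lambda>a j k. \<Sum>b\<in>B. \<Sum>c\<in>C. g j b * h k c * T a b c) r"
  using border_rank_le_map[OF assms(1), of A E F "\<lambda>i a. of_bool (i = a)" g h]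
proof (rule border_rank_le_cong)
  fix a j k assume "a \<in> A"
  have "tensor_map A B C (\<lambda>i a. of_bool (i = a)) g h T a j k
      = (\<Sum>a'\<in>A. of_bool (a = a') * (\<Sum>b\<in>B. \<Sum>c\<in>C. g j b * h k c * T a' b c))"
    unfolding tensor_map_def by (simp add: sum_distrib_left mult_ac)
  then show "tensor_map A B C (\<lambda>i a. of_bool (i = a)) g h T a j k = (\<Sum>b\<in>B. \<Sum>c\<in>C. g j b * h k c * T a b c)"
    using \<open>a \<in> A\<close> \<open>finite A\<close> by (simp add: of_bool_def mult_delta_left)
qed

text \<open>If \<open>f\<close> kills the moved vector, then \<open>f\<close> composed with
  \<open>compound N\<close> kills \<open>u\<close>. Applying \<open>N\<close> to the other two
  factors turns the resulting slices back into those of \<open>f\<close>, by invariance of the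
  tensor. The condition on \<open>Z\<close> says that \<open>N\<close> preserves the span of
  \<open>Z\<close> and so acts on the quotient.\<close>

lemma killed_rank_le_isometry:
  assumes iso: "\<And>a b. a < 5 \<Longrightarrow> b < 5 \<Longrightarrow> (\<Sum>c<5. N a c * (\<Sum>d<5. N b d * split_form c d)) = split_form a b"
    and Z: "Z \<subseteq> so5_index" "\<And>p z. p \<in> so5_index - Z \<Longrightarrow> z \<in> Z \<Longrightarrow> compound N p z = 0"
    and u: "killed_rank_le Z u r"
  shows "killed_rank_le Z (\<lambda>p. \<Sum>q\<in>so5_index - Z. compound N p q * u q) r"
  unfolding killed_rank_le_def
proof (intro allI impI)
  let ?A = "so5_index - Z"
  fix f :: "nat \<times> nat \<Rightarrow> nat \<times> nat \<Rightarrow> complex"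
  assume f: "\<forall>i\<in>so5_index. (\<Sum>p\<in>?A. f i p * (\<Sum>q\<in>?A. compound N p q * u q)) = 0"
  define g where "g i q = (\<Sum>p\<in>?A. f i p * compound N p q)" for i q
  have "(\<Sum>q\<in>?A. g i q * u q) = (\<Sum>p\<in>?A. f i p * (\<Sum>q\<in>?A. compound N p q * u q))" for i
    unfolding g_def sum_distrib_left sum_distrib_right by (subst sum.swap) (simp add: mult.assoc)
  then have "border_rank_le so5_index so5_index so5_index (slice_map ?A g bracket_tensor) r"
    using u f unfolding killed_rank_le_def by auto
  from border_rank_le_map23[OF this, of so5_index so5_index "compound N" "compound N"]
  show "border_rank_le so5_index so5_index so5_index (slice_map ?A f bracket_tensor) r"
  proof (rule border_rank_le_cong)
    fix i j k assume jk: "j \<in> so5_index" "k \<in> so5_index"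
    have "bracket_tensor p j k = (\<Sum>q\<in>?A. compound N p q *
        (\<Sum>b\<in>so5_index. \<Sum>c\<in>so5_index. compound N j b * compound N k c * bracket_tensor q b c))"
      if "p \<in> ?A" for p
    proof -
      have "bracket_tensor p j k = (\<Sum>q\<in>so5_index. compound N p q *
          (\<Sum>b\<in>so5_index. \<Sum>c\<in>so5_index. compound N j b * compound N k c * bracket_tensor q b c))"
        using tensor_map_compound[where P = N and F = split_form and F' = split_form and p = p, OF iso _ jk] that unfolding tensor_map_def
        by (simp add: sum_distrib_left mult_ac)
      also have "\<dots> = (\<Sum>q\<in>?A. compound N p q *
          (\<Sum>b\<in>so5_index. \<Sum>c\<in>so5_index. compound N j b * compound N k c * bracket_tensor q b c))"
        using Z that by (intro sum.mono_neutral_right) auto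
      finally show ?thesis .
    qed
    then have "slice_map ?A f bracket_tensor i j k = (\<Sum>p\<in>?A. f i p * (\<Sum>q\<in>?A. compound N p q *
        (\<Sum>b\<in>so5_index. \<Sum>c\<in>so5_index. compound N j b * compound N k c * bracket_tensor q b c)))"
      unfolding slice_map_def by (intro sum.cong) auto
    also have "\<dots> = (\<Sum>q\<in>?A. g i q *
        (\<Sum>b\<in>so5_index. \<Sum>c\<in>so5_index. compound N j b * compound N k c * bracket_tensor q b c))"
      unfolding g_def sum_distrib_right
      by (subst sum.swap) (simp add: sum_distrib_left mult.assoc)
    also have "\<dots> = (\<Sum>b\<in>so5_index. \<Sum>c\<in>so5_index. compound N j b * compound N k c * slice_map ?A g bracket_tensor i b c)"
      unfolding slice_map_def sum_distrib_left
      by (simp only: sum.swap[of _ ?A]) (simp add: mult_ac)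
    finally show "(\<Sum>b\<in>so5_index. \<Sum>c\<in>so5_index. compound N j b * compound N k c * slice_map ?A g bracket_tensor i b c)
      = slice_map ?A f bracket_tensor i j k" ..
  qed auto
qed

text \<open>Projectively, the orbit point tends to its leading coefficient as \<open>s\<close> goes
  to infinity: \<open>y\<close> if this is nonzero outside \<open>Z\<close>, otherwise
  \<open>x\<close>. The sequence \<open>t\<close> stands for \<open>1 / s\<close>.\<close>

lemma killed_rank_le_leading:
  assumes u: "\<And>s :: complex. killed_rank_le Z (\<lambda>a. u a + s * x a + s\<^sup>2 * y a) r"
    and nz: "\<exists>a\<in>so5_index - Z. x a \<noteq> 0 \<or> y a \<noteq> 0"
  shows "\<exists>w. (w = x \<or> w = y) \<and> killed_rank_le Z w r \<and> (\<exists>a\<in>so5_index - Z. w a \<noteq> 0)"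
proof -
  define t :: "nat \<Rightarrow> complex" where "t n = inverse (of_nat (Suc n))" for n
  have t: "t n \<noteq> 0" for n
    unfolding t_def by (simp del: of_nat_Suc)
  have t_lim: "t \<longlonglongrightarrow> 0"
    unfolding t_def using LIMSEQ_Suc[OF lim_inverse_n] by (simp add: o_def)
  show ?thesis
  proof (cases "\<exists>a\<in>so5_index - Z. y a \<noteq> 0")
    case True
    then obtain p where p: "p \<in> so5_index - Z" "y p \<noteq> 0" by blast
    have "(t n)\<^sup>2 * (u a + inverse (t n) * x a + (inverse (t n))\<^sup>2 * y a) = (t n)\<^sup>2 * u a + t n * x a + y a" for n a
      using t[of n] by (simp add: field_simps power2_eq_square)
    then have y: "killed_rank_le Z (\<lambda>a. (t n)\<^sup>2 * u a + t n * x a + y a) r" for n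
      using killed_rank_le_scale[OF u[of "inverse (t n)"], of "(t n)\<^sup>2"] t[of n] by simp
    have y_lim: "(\<lambda>n. (t n)\<^sup>2 * u a + t n * x a + y a) \<longlonglongrightarrow> 0\<^sup>2 * u a + 0 * x a + y a" for a
      by (intro tendsto_intros t_lim)
    have "killed_rank_le Z y r"
      by (rule killed_rank_le_limit[where u = y, OF y p]) (use y_lim in simp)
    then show ?thesis using p by blast
  next
    case False
    then obtain p where p: "p \<in> so5_index - Z" "x p \<noteq> 0" using nz by blast
    have "t n * (u a + inverse (t n) * x a + (inverse (t n))\<^sup>2 * y a) = t n * u a + x a + inverse (t n) * y a" for n a
      using t[of n] by (simp add: field_simps power2_eq_square)
    then have "killed_rank_le Z (\<lambda>a. t n * u a + x a + inverse (t n) * y a) r" for n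
      using killed_rank_le_scale[OF u[of "inverse (t n)"], of "t n"] t[of n] by simp
    then have x: "killed_rank_le Z (\<lambda>a. t n * u a + x a) r" for n
      by (rule killed_rank_le_cong) (use False in auto)
    have x_lim: "(\<lambda>n. t n * u a + x a) \<longlonglongrightarrow> 0 * u a + x a" for a
      by (intro tendsto_intros t_lim)
    have "killed_rank_le Z x r"
      by (rule killed_rank_le_limit[where u = x, OF x p]) (use x_lim in simp)
    then show ?thesis using p by blast
  qed
qed

section \<open>Root subgroups and the climb to the highest weight\<close>

text \<open>\<open>unipotent1\<close> and \<open>unipotent2\<close> are the exponentials of root
  vectors for the long and the short simple root of type B2. The long one squares to zero on
  \<open>\<complex>\<^sup>5\<close>; the short one does not, whence the term
  \<open>s\<^sup>2 / 2\<close>.\<close>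

definition unipotent1 :: "complex \<Rightarrow> nat \<Rightarrow> nat \<Rightarrow> complex" where
  "unipotent1 s a c = (if a = c then 1 else if a = 0 \<and> c = 1 then s else if a = 3 \<and> c = 4 then - s else 0)"

definition unipotent2 :: "complex \<Rightarrow> nat \<Rightarrow> nat \<Rightarrow> complex" where
  "unipotent2 s a c = (if a = c then 1 else if a = 1 \<and> c = 2 then s else if a = 1 \<and> c = 3 then - (s\<^sup>2 / 2)
     else if a = 2 \<and> c = 3 then - s else 0)"

lemma unipotent1_isometry:
  assumes "a < 5" "b < 5"
  shows "(\<Sum>c<5. unipotent1 s a c * (\<Sum>d<5. unipotent1 s b d * split_form c d)) = split_form a b"
  using less_5_cases[OF assms(1)] less_5_cases[OF assms(2)]
  by (elim disjE) (simp_all add: unipotent1_def lessThan_5 split_form_def)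

lemma unipotent2_isometry:
  assumes "a < 5" "b < 5"
  shows "(\<Sum>c<5. unipotent2 s a c * (\<Sum>d<5. unipotent2 s b d * split_form c d)) = split_form a b"
  using less_5_cases[OF assms(1)] less_5_cases[OF assms(2)]
  by (elim disjE) (simp_all add: unipotent2_def lessThan_5 split_form_def power2_eq_square)

text \<open>The action of a simple root vector on the exterior square; the variants with suffix
  \<open>_sq\<close> are half its square. These are the coefficients of \<open>s\<close> and
  \<open>s\<^sup>2\<close>, and higher powers vanish because root strings of the adjoint
  representation of B2 have at most three members.\<close>

definition raise1 :: "(nat \<times> nat \<Rightarrow> complex) \<Rightarrow> nat \<times> nat \<Rightarrow> complex" where
  "raise1 u p = (if p = (0,2) then u (1,2) else if p = (0,3) then u (1,3) - u (0,4) else if p = (0,4) then u (1,4)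
     else if p = (1,3) then - u (1,4) else if p = (2,3) then - u (2,4) else 0)"

definition raise1_sq :: "(nat \<times> nat \<Rightarrow> complex) \<Rightarrow> nat \<times> nat \<Rightarrow> complex" where
  "raise1_sq u p = (if p = (0,3) then - u (1,4) else 0)"

definition raise2 :: "(nat \<times> nat \<Rightarrow> complex) \<Rightarrow> nat \<times> nat \<Rightarrow> complex" where
  "raise2 u p = (if p = (0,1) then u (0,2) else if p = (0,2) then - u (0,3) else if p = (1,2) then - u (1,3)
     else if p = (1,3) then u (2,3) else if p = (1,4) then u (2,4) else if p = (2,4) then - u (3,4) else 0)"

definition raise2_sq :: "(nat \<times> nat \<Rightarrow> complex) \<Rightarrow> nat \<times> nat \<Rightarrow> complex" where
  "raise2_sq u p = (if p = (0,1) then - u (0,3) / 2 else if p = (1,2) then - u (2,3) / 2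
     else if p = (1,4) then - u (3,4) / 2 else 0)"

lemma compound_unipotent1:
  assumes "p \<in> so5_index"
  shows "(\<Sum>q\<in>so5_index. compound (unipotent1 s) p q * u q) = u p + s * raise1 u p + s\<^sup>2 * raise1_sq u p"
  using assms unfolding so5_index_eq
  by (elim insertE emptyE) (simp_all add: unipotent1_def raise1_def raise1_sq_def power2_eq_square algebra_simps)

lemma compound_unipotent2:
  assumes "p \<in> so5_index"
  shows "(\<Sum>q\<in>so5_index. compound (unipotent2 s) p q * u q) = u p + s * raise2 u p + s\<^sup>2 * raise2_sq u p"
  using assms unfolding so5_index_eq
  by (elim insertE emptyE) (simp_all add: unipotent2_def raise2_def raise2_sq_def power2_eq_square field_simps)

text \<open>The line of the highest weight vector is stable under both groups, so they still act
  after it has been factored out.\<close>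

lemma compound_unipotent_fixes:
  assumes "p \<in> so5_index" "p \<noteq> (0,1)"
  shows "compound (unipotent1 s) p (0,1) = 0" "compound (unipotent2 s) p (0,1) = 0"
  using assms unfolding so5_index_eq
  by (elim insertE emptyE; simp add: unipotent1_def unipotent2_def)+

text \<open>The unipotent isometries strictly decrease \<open>fst p + snd p\<close> (they raise weights); only \<open>hw\<close> is annihilated by both.\<close>

lemma killed_rank_le_top:
  assumes Z: "Z = {} \<and> hw = (0,1) \<or> Z = {(0,1)} \<and> hw = (0,2)"
  shows "killed_rank_le Z u r \<Longrightarrow> \<exists>p\<in>so5_index - Z. u p \<noteq> 0 \<Longrightarrow>
      \<forall>p\<in>so5_index - Z. u p \<noteq> 0 \<longrightarrow> fst p + snd p \<le> d \<Longrightarrow>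
    \<exists>w. killed_rank_le Z w r \<and> (\<forall>p\<in>so5_index - Z. p \<noteq> hw \<longrightarrow> w p = 0)"
proof (induction d arbitrary: u)
  case 0
  then show ?case by (fastforce simp: so5_index_def)
next
  case (Suc d)
  \<comment> \<open>Clearing the coordinates in \<open>Z\<close> changes nothing modulo
    \<open>Z\<close> and lets the orbit formulas, which sum over all of \<open>so5_index\<close>, be
    applied.\<close>
  define v where "v p = (if p \<in> Z then 0 else u p)" for p
  have v: "killed_rank_le Z v r"
    using Suc.prems(1) by (rule killed_rank_le_cong) (simp add: v_def)
  have depth: "v p = 0" if "fst p + snd p > Suc d" "p \<in> so5_index" for p
    using Suc.prems(3) that by (force simp: v_def)
  have sum_v: "(\<Sum>q\<in>so5_index - Z. c q * v q) = (\<Sum>q\<in>so5_index. c q * v q)" for c :: "nat \<times> nat \<Rightarrow> complex"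
    by (intro sum.mono_neutral_left) (auto simp: v_def)
  have Z': "Z \<subseteq> so5_index" "\<And>p z. p \<in> so5_index - Z \<Longrightarrow> z \<in> Z \<Longrightarrow> p \<noteq> (0,1) \<and> z = (0,1)"
    using Z by (auto simp: so5_index_eq)
  have fix1: "compound (unipotent1 s) p z = 0" if "p \<in> so5_index - Z" "z \<in> Z" for p z s
    using Z'(2)[OF that] compound_unipotent_fixes(1)[of p s] that by simp
  have orbit1: "killed_rank_le Z (\<lambda>p. v p + s * raise1 v p + s\<^sup>2 * raise1_sq v p) r" for s
    by (rule killed_rank_le_cong[OF killed_rank_le_isometry[OF unipotent1_isometry[where s = s] Z'(1) fix1 v]])
      (simp_all add: sum_v compound_unipotent1)
  have fix2: "compound (unipotent2 s) p z = 0" if "p \<in> so5_index - Z" "z \<in> Z" for p z s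
    using Z'(2)[OF that] compound_unipotent_fixes(2)[of p s] that by simp
  have orbit2: "killed_rank_le Z (\<lambda>p. v p + s * raise2 v p + s\<^sup>2 * raise2_sq v p) r" for s
    by (rule killed_rank_le_cong[OF killed_rank_le_isometry[OF unipotent2_isometry[where s = s] Z'(1) fix2 v]])
      (simp_all add: sum_v compound_unipotent2)
  have depth_raise: "fst p + snd p \<le> d" if "w \<in> {raise1 v, raise1_sq v, raise2 v, raise2_sq v}" "p \<in> so5_index" "w p \<noteq> 0" for w p
  proof (rule ccontr)
    assume "\<not> fst p + snd p \<le> d"
    then have "w p = 0"
      using that(1,2) depth unfolding so5_index_eq
      by (elim insertE emptyE) (simp_all add: raise1_def raise1_sq_def raise2_def raise2_sq_def)
    then show False using that(3) by simp
  qed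
  show ?case
  proof (cases "\<exists>a\<in>so5_index - Z. raise1 v a \<noteq> 0 \<or> raise1_sq v a \<noteq> 0 \<or> raise2 v a \<noteq> 0 \<or> raise2_sq v a \<noteq> 0")
    case True
    then obtain w where "w \<in> {raise1 v, raise1_sq v, raise2 v, raise2_sq v}" "killed_rank_le Z w r"
      "\<exists>a\<in>so5_index - Z. w a \<noteq> 0"
      using killed_rank_le_leading[OF orbit1] killed_rank_le_leading[OF orbit2] by blast
    then show ?thesis using Suc.IH depth_raise by blast
  next
    case False
    then have null: "raise1 v a = 0" "raise1_sq v a = 0" "raise2 v a = 0" "raise2_sq v a = 0" if "a \<in> so5_index - Z" for a
      using that by blast+
    have mem: "(0,2) \<in> so5_index - Z" "(0,3) \<in> so5_index - Z" "(1,2) \<in> so5_index - Z" "(2,3) \<in> so5_index - Z"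
      "(2,4) \<in> so5_index - Z"
      using Z by (auto simp: so5_index_eq)
    have zero: "v (1,2) = 0" "v (0,3) = 0" "v (1,4) = 0" "v (0,4) = v (1,3)" "v (1,3) = 0" "v (2,3) = 0" "v (2,4) = 0" "v (3,4) = 0"
      using null(1)[OF mem(1)] null(3)[OF mem(1)] null(2)[OF mem(2)] null(1)[OF mem(2)] null(3)[OF mem(3)] null(4)[OF mem(3)]
        null(1)[OF mem(4)] null(3)[OF mem(5)]
      by (simp_all add: raise1_def raise1_sq_def raise2_def raise2_sq_def)
    \<comment> \<open>The coordinate \<open>(0,2)\<close> is detected only by the component
      \<open>(0,1)\<close> of \<open>raise2 v\<close>. Once \<open>(0,1)\<close> is factored out it
      survives, being the highest weight of the quotient.\<close>
    have "v (0,2) = 0" if "Z = {}"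
      using null(3)[of "(0,1)"] that by (simp add: raise2_def so5_index_eq)
    then have "v p = 0" if "p \<in> so5_index - Z" "p \<noteq> hw" for p
      using that Z zero unfolding so5_index_eq by fastforce
    then show ?thesis using v by blast
  qed
qed

lemma border_rank_le_kill_top:
  assumes Z: "Z = {} \<and> hw = (0,1) \<or> Z = {(0,1)} \<and> hw = (0,2)"
    and br: "border_rank_le (so5_index - Z) so5_index so5_index bracket_tensor (Suc r)"
  shows "border_rank_le (so5_index - insert hw Z) so5_index so5_index bracket_tensor r"
proof -
  have idx: "(1,3) \<in> so5_index - Z" "(0,1) \<in> so5_index" "(3,4) \<in> so5_index"
    using Z by (auto simp: so5_index_eq)
  \<comment> \<open>\<open>f\<^sub>1 \<and> f\<^sub>3\<close> lies in the Cartan subalgebra and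
    scales the root vector \<open>f\<^sub>0 \<and> f\<^sub>1\<close> by a nonzero factor, while
    \<open>f\<^sub>3 \<and> f\<^sub>4\<close> pairs with that vector to -1. This slice is present in
    both rounds.\<close>
  have "bracket_tensor (1,3) (0,1) (3,4) \<noteq> 0"
    by (simp add: split_form_def)
  from border_substitution[OF br _ idx this] obtain u where u: "\<exists>a\<in>so5_index - Z. u a \<noteq> 0" "killed_rank_le Z u r"
    unfolding killed_rank_le_def by auto
  moreover have "fst p + snd p \<le> 7" if "p \<in> so5_index" for p
    using that by (auto simp: so5_index_def)
  ultimately obtain w where w: "killed_rank_le Z w r" "\<And>p. p \<in> so5_index - Z \<Longrightarrow> p \<noteq> hw \<Longrightarrow> w p = 0"
    using killed_rank_le_top[OF Z, of u r 7] by blast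
  define f :: "nat \<times> nat \<Rightarrow> nat \<times> nat \<Rightarrow> complex" where "f i a = (if a = i \<and> i \<noteq> hw then 1 else 0)" for i a
  have "(\<Sum>a\<in>so5_index - Z. f i a * w a) = 0" for i
    using w(2) by (intro sum.neutral) (auto simp: f_def)
  then have "border_rank_le so5_index so5_index so5_index (slice_map (so5_index - Z) f bracket_tensor) r"
    using w(1) unfolding killed_rank_le_def by blast
  then have "border_rank_le (so5_index - insert hw Z) so5_index so5_index (slice_map (so5_index - Z) f bracket_tensor) r"
    by (rule border_rank_le_subset) auto
  then show ?thesis
  proof (rule border_rank_le_cong)
    fix a b c assume a: "a \<in> so5_index - insert hw Z"
    have "slice_map (so5_index - Z) f bracket_tensor a b c = (\<Sum>p\<in>so5_index - Z. if p = a then bracket_tensor a b c else 0)"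
      unfolding slice_map_def using a by (intro sum.cong) (auto simp: f_def)
    then show "slice_map (so5_index - Z) f bracket_tensor a b c = bracket_tensor a b c"
      using a by simp
  qed
qed

lemma border_rank_le_restricted:
  assumes "border_rank_le so5_index so5_index so5_index T_so5 (Suc (Suc r))"
  shows "border_rank_le (so5_index - {(0,1), (0,2)}) so5_index so5_index bracket_tensor r"
  using border_rank_le_kill_top[of "{}" "(0,1)" "Suc r"] border_rank_le_kill_top[of "{(0,1)}" "(0,2)" r]
    border_rank_le_bracket_tensor[OF assms]
  by (simp add: insert_commute)

section \<open>Koszul flattenings\<close>

text \<open>Padded to square shape, the left factor acquires a zero last column.\<close>

lemma det_factor_eq_0:
  fixes a b :: "nat \<Rightarrow> 'm \<Rightarrow> complex"
  assumes "finite M" "card M < N"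
  shows "Determinant.det (Matrix.mat N N (\<lambda>(i, j). \<Sum>m\<in>M. a i m * b j m)) = 0"
proof -
  obtain h where h: "bij_betw h {..<card M} M"
    using ex_bij_betw_nat_finite[OF \<open>finite M\<close>] by (auto simp: atLeast0LessThan)
  define A where "A = Matrix.mat N N (\<lambda>(i, m). if m < card M then a i (h m) else 0)"
  define B where "B = Matrix.mat N N (\<lambda>(m, j). if m < card M then b j (h m) else 0)"
  have A: "A \<in> carrier_mat N N" and B: "B \<in> carrier_mat N N"
    by (auto simp: A_def B_def)
  have "Matrix.mat N N (\<lambda>(i, j). \<Sum>m\<in>M. a i m * b j m) = A * B"
  proof (rule eq_matI)
    fix i j assume "i < dim_row (A * B)" "j < dim_col (A * B)"
    then have ij: "i < N" "j < N" using A B by auto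
    have "(\<Sum>m\<in>M. a i m * b j m) = (\<Sum>m<card M. a i (h m) * b j (h m))"
      using sum.reindex_bij_betw[OF h, of "\<lambda>m. a i m * b j m"] by simp
    also have "\<dots> = (\<Sum>m\<in>{0..<N}. (if m < card M then a i (h m) else 0) * (if m < card M then b j (h m) else 0))"
      using \<open>card M < N\<close> by (intro sum.mono_neutral_cong_left) auto
    also have "\<dots> = (A * B) $$ (i, j)"
      using ij by (simp add: A_def B_def scalar_prod_def)
    finally show "Matrix.mat N N (\<lambda>(i, j). \<Sum>m\<in>M. a i m * b j m) $$ (i, j) = (A * B) $$ (i, j)"
      using ij by simp
  qed (use A B in auto)
  moreover have "Determinant.det A = 0"
  proof -
    have "A *\<^sub>v unit_vec N (N - 1) = 0\<^sub>v N"
    proof (rule eq_vecI)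
      fix i assume "i < dim_vec (0\<^sub>v N :: complex Matrix.vec)"
      then show "vec_index (A *\<^sub>v unit_vec N (N - 1)) i = vec_index (0\<^sub>v N) i"
        using \<open>card M < N\<close> by (simp add: A_def)
    qed (simp add: A_def)
    moreover have "unit_vec N (N - 1) \<noteq> (0\<^sub>v N :: complex Matrix.vec)"
      using \<open>card M < N\<close> by simp
    ultimately show ?thesis
      using det_0_iff_vec_prod_zero[OF A] by (metis unit_vec_carrier)
  qed
  ultimately show ?thesis
    using det_mult[OF A B] by simp
qed

lemma tendsto_det:
  fixes f :: "'x \<Rightarrow> nat \<Rightarrow> nat \<Rightarrow> complex"
  assumes "\<And>i j. i < N \<Longrightarrow> j < N \<Longrightarrow> ((\<lambda>x. f x i j) \<longlongrightarrow> g i j) F"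
  shows "((\<lambda>x. Determinant.det (Matrix.mat N N (\<lambda>(i, j). f x i j))) \<longlongrightarrow>
    Determinant.det (Matrix.mat N N (\<lambda>(i, j). g i j))) F"
proof -
  have det: "Determinant.det (Matrix.mat N N (\<lambda>(i, j). f i j)) =
      (\<Sum>p\<in>{p. p permutes {0..<N}}. signof p * (\<Prod>i = 0..<N. f i (p i)))" for f :: "nat \<Rightarrow> nat \<Rightarrow> complex"
    by (subst det_def'[of _ N]) (auto intro!: sum.cong prod.cong simp: permutes_in_image)
  show ?thesis
    unfolding det by (intro tendsto_sum tendsto_mult_left tendsto_prod assms) (auto simp: permutes_in_image)
qed

section \<open>Alternating signs and wedging with a vector\<close>

type_synonym triple = "int \<times> int \<times> int"

text \<open>The sign of the permutation sorting \<open>xs\<close>, and \<open>0\<close> if \<open>xs\<close> has a repeated entry.\<close>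

fun sort_sign :: "int list \<Rightarrow> int" where
  "sort_sign [] = 1"
| "sort_sign (x # xs) = prod_list (map (\<lambda>y. sgn (y - x)) xs) * sort_sign xs"

text \<open>For indices in \<open>{0..6}\<close> this is the coefficient of the volume form in
  \<open>e\<^sub>i \<and> e\<^sub>S \<and> e\<^sub>R\<close>, since seven distinct indices exhaust
  the range.\<close>

fun sort_sign3 :: "int \<Rightarrow> triple \<Rightarrow> triple \<Rightarrow> int" where
  "sort_sign3 i (a, b, c) (d, e, f) = sort_sign [i, a, b, c, d, e, f]"

lemma sort_sign_swap: "sort_sign (ys @ x # y # xs) = - sort_sign (ys @ y # x # xs)"
proof (induction ys)
  case Nil
  have "sgn (y - x) = - sgn (x - y)" by (simp add: sgn_if)
  then show ?case by (simp add: mult_ac)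
next
  case (Cons z ys)
  then show ?case by (simp add: mult_ac)
qed

lemma sort_sign_repeated: "sort_sign (ys @ x # x # xs) = 0"
  by (induction ys) auto

definition wedge :: "(int \<Rightarrow> complex) \<Rightarrow> triple \<Rightarrow> triple \<Rightarrow> complex" where
  "wedge u S R = (\<Sum>i\<in>{0..6}. u i * of_int (sort_sign3 i S R))"

lemma wedge_swap:
  "wedge u (b, a, c) R = - wedge u (a, b, c) R" "wedge u (a, c, b) R = - wedge u (a, b, c) R"
  unfolding wedge_def sum_negf[symmetric]
  using sort_sign_swap[of "[_]" b a] sort_sign_swap[of "[_, a]" c b]
  by (cases R; simp del: sort_sign.simps)+

lemma wedge_repeated: "wedge u (a, a, c) R = 0" "wedge u (a, c, c) R = 0"
  unfolding wedge_def using sort_sign_repeated[of "[_]" a] sort_sign_repeated[of "[_, a]" c]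
  by (cases R; simp del: sort_sign.simps)+

text \<open>This is \<open>u \<and> u = 0\<close>: the double sum is antisymmetric in its two
  indices and hence equals its own negative.\<close>

lemma wedge_wedge: "(\<Sum>k\<in>{0..6}. u k * wedge u (k, a, b) R) = 0"
proof -
  obtain d e f where R: "R = (d, e, f)" by (cases R)
  let ?g = "\<lambda>k i. u k * u i * of_int (sort_sign [i, k, a, b, d, e, f])"
  have *: "(\<Sum>k\<in>{0..6}. u k * wedge u (k, a, b) R) = (\<Sum>k\<in>{0..6}. \<Sum>i\<in>{0..6}. ?g k i)"
    unfolding wedge_def R by (simp add: sum_distrib_left mult.assoc)
  have neg: "?g k i = - ?g i k" for k i
    using sort_sign_swap[of "[]" i k "[a, b, d, e, f]"] by (simp del: sort_sign.simps add: mult_ac)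
  have "(\<Sum>k\<in>{0..6}. \<Sum>i\<in>{0..6}. ?g k i) = (\<Sum>k\<in>{0..6}. \<Sum>i\<in>{0..6}. - ?g i k)"
    by (intro sum.cong refl neg)
  also have "\<dots> = - (\<Sum>k\<in>{0..6}. \<Sum>i\<in>{0..6}. ?g i k)"
    by (simp only: sum_negf)
  also have "\<dots> = - (\<Sum>k\<in>{0..6}. \<Sum>i\<in>{0..6}. ?g k i)"
    by (intro arg_cong[of _ _ uminus] sum.swap)
  finally have "(\<Sum>k\<in>{0..6}. \<Sum>i\<in>{0..6}. ?g k i) = 0"
    by (simp only: complex_eq_iff) simp
  with * show ?thesis by (simp only:)
qed

definition triples :: "triple list" where
  "triples = (let D = [6,5,4,3,2,1,0] in
     concat (map (\<lambda>a. concat (map (\<lambda>b. if a < b then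
       concat (map (\<lambda>c. if b < c then [(a, b, c)] else []) D) else []) D)) D))"

definition upper_triples :: "triple list" where
  "upper_triples = filter (\<lambda>(a, b, c). a \<noteq> 0) triples"

lemma triples_eq:
  "triples =
   [(4,5,6),(3,5,6),(3,4,6),(3,4,5),(2,5,6),(2,4,6),(2,4,5),(2,3,6),(2,3,5),(2,3,4),
    (1,5,6),(1,4,6),(1,4,5),(1,3,6),(1,3,5),(1,3,4),(1,2,6),(1,2,5),(1,2,4),(1,2,3),
    (0,5,6),(0,4,6),(0,4,5),(0,3,6),(0,3,5),(0,3,4),(0,2,6),(0,2,5),(0,2,4),(0,2,3),
    (0,1,6),(0,1,5),(0,1,4),(0,1,3),(0,1,2)]"
  by code_simp

lemma upper_triples_eq:
  "upper_triples =
   [(4,5,6),(3,5,6),(3,4,6),(3,4,5),(2,5,6),(2,4,6),(2,4,5),(2,3,6),(2,3,5),(2,3,4),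
    (1,5,6),(1,4,6),(1,4,5),(1,3,6),(1,3,5),(1,3,4),(1,2,6),(1,2,5),(1,2,4),(1,2,3)]"
  by (simp add: upper_triples_def triples_eq)

text \<open>Modulo \<open>u\<close>, the basis vector \<open>e\<^sub>0\<close> is the combination \<open>- (\<Sum>k>0. u k e\<^sub>k) / u 0\<close>; hence wedging with \<open>u\<close>
  only sees the triples avoiding \<open>0\<close>.\<close>

fun reduce_triple :: "(int \<Rightarrow> complex) \<Rightarrow> triple \<Rightarrow> triple \<Rightarrow> complex" where
  "reduce_triple u (s, a, b) (p, q, r) =
     (if s = 0 then - (of_bool (q = a \<and> r = b) * u p - of_bool (p = a \<and> r = b) * u q + of_bool (p = a \<and> q = b) * u r) / u 0
      else of_bool ((s, a, b) = (p, q, r)))"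

lemma wedge_reduce:
  assumes "u 0 \<noteq> 0" "S \<in> set triples"
  shows "wedge u S R = (\<Sum>Q\<in>set upper_triples. reduce_triple u S Q * wedge u Q R)"
proof -
  define f where "f S = wedge u S R" for S
  have alt: "f (b, a, c) = - f (a, b, c)" "f (a, c, b) = - f (a, b, c)" "f (a, a, c) = 0" "f (a, c, c) = 0" for a b c
    unfolding f_def by (fact wedge_swap wedge_repeated)+
  have rel: "u 0 * f (0, a, b) + u 1 * f (1, a, b) + u 2 * f (2, a, b) + u 3 * f (3, a, b) + u 4 * f (4, a, b)
      + u 5 * f (5, a, b) + u 6 * f (6, a, b) = 0" for a b
  proof -
    have "{0..6::int} = {0,1,2,3,4,5,6}" by auto
    then show ?thesis using wedge_wedge[of u a b R] by (simp add: f_def add.assoc)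
  qed
  have "f S = (\<Sum>Q\<in>set upper_triples. reduce_triple u S Q * f Q)"
  proof (cases "fst S = 0")
    case False
    then have "S \<in> set upper_triples"
      using assms(2) by (cases S) (auto simp: upper_triples_def)
    moreover have "reduce_triple u S Q = of_bool (S = Q)" for Q
      using False by (cases S; cases Q) simp
    ultimately show ?thesis by (simp add: of_bool_def mult_delta_left)
  next
    case True
    then obtain a b where S: "S = (0, a, b)" by (cases S) auto
    have f0: "f (0, a, b) = - (u 1 * f (1, a, b) + u 2 * f (2, a, b) + u 3 * f (3, a, b) + u 4 * f (4, a, b)
      + u 5 * f (5, a, b) + u 6 * f (6, a, b)) / u 0"
      using rel[of a b] \<open>u 0 \<noteq> 0\<close> by (simp add: field_simps eq_neg_iff_add_eq_0 add_ac)
    \<comment> \<open>Substituting for \<open>e\<^sub>0\<close> produces triples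
      \<open>(k, a, b)\<close> in arbitrary order; in each of the fifteen cases the alternating
      rules sort them or make them vanish.\<close>
    have "(a, b) \<in> {(5,6),(4,6),(4,5),(3,6),(3,5),(3,4),(2,6),(2,5),(2,4),(2,3),(1,6),(1,5),(1,4),(1,3),(1,2)}"
      using assms(2) unfolding S triples_eq by auto
    then show ?thesis
      unfolding S f0 upper_triples_eq
      using \<open>u 0 \<noteq> 0\<close>
      by (elim insertE emptyE; clarify; simp add: alt(3,4) add_divide_distrib diff_divide_distrib
        alt(1)[of 1 2] alt(1)[of 1 3] alt(1)[of 1 4] alt(1)[of 1 5] alt(1)[of 1 6]
        alt(1)[of 2 3] alt(1)[of 2 4] alt(1)[of 2 5] alt(1)[of 2 6] alt(1)[of 3 4]
        alt(1)[of 3 5] alt(1)[of 3 6] alt(1)[of 4 5] alt(1)[of 4 6] alt(1)[of 5 6]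
        alt(2)[of _ 1 2] alt(2)[of _ 1 3] alt(2)[of _ 1 4] alt(2)[of _ 1 5] alt(2)[of _ 1 6]
        alt(2)[of _ 2 3] alt(2)[of _ 2 4] alt(2)[of _ 2 5] alt(2)[of _ 2 6] alt(2)[of _ 3 4]
        alt(2)[of _ 3 5] alt(2)[of _ 3 6] alt(2)[of _ 4 5] alt(2)[of _ 4 6] alt(2)[of _ 5 6])
  qed
  then show ?thesis by (simp add: f_def)
qed

text \<open>The Koszul flattening \<open>\<Lambda>\<^sup>3 \<otimes> J \<rightarrow> \<Lambda>\<^sup>4 \<otimes> K\<close>, with \<open>\<Lambda>\<^sup>4\<close> identified with the dual of \<open>\<Lambda>\<^sup>3\<close>
  by the volume form of the 7-dimensional space.\<close>

definition koszul :: "(int \<Rightarrow> 'j \<Rightarrow> 'k \<Rightarrow> 'a::comm_ring_1) \<Rightarrow> triple \<times> 'j \<Rightarrow> triple \<times> 'k \<Rightarrow> 'a" where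
  "koszul X \<rho> \<kappa> = (\<Sum>i\<in>{0..6}. of_int (sort_sign3 i (fst \<rho>) (fst \<kappa>)) * X i (snd \<rho>) (snd \<kappa>))"

section \<open>Minors of the flattening vanish for small border rank\<close>

text \<open>\<open>lam\<close> combines rows and \<open>mu\<close> combines columns. Bounding the
  rank through such determinants keeps the condition polynomial in \<open>X\<close>, so it passes to
  limits.\<close>

definition koszul_minor where
  "koszul_minor J K N lam mu X = Determinant.det (Matrix.mat N N (\<lambda>(m, n).
     \<Sum>\<rho>\<in>set triples \<times> J. \<Sum>\<kappa>\<in>set triples \<times> K. lam m \<rho> * mu n \<kappa> * (koszul X \<rho> \<kappa> :: complex)))"

lemma koszul_minor_cong:
  assumes "\<And>i j k. i \<in> {0..6} \<Longrightarrow> j \<in> J \<Longrightarrow> k \<in> K \<Longrightarrow> X i j k = Y i j k"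
  shows "koszul_minor J K N lam mu X = koszul_minor J K N lam mu Y"
proof -
  have "(\<Sum>\<rho>\<in>set triples \<times> J. \<Sum>\<kappa>\<in>set triples \<times> K. lam m \<rho> * mu n \<kappa> * koszul X \<rho> \<kappa>) =
      (\<Sum>\<rho>\<in>set triples \<times> J. \<Sum>\<kappa>\<in>set triples \<times> K. lam m \<rho> * mu n \<kappa> * koszul Y \<rho> \<kappa>)" for m n
    unfolding koszul_def using assms by (intro sum.cong refl arg_cong2[of _ _ _ _ "(*)"]) auto
  then show ?thesis unfolding koszul_minor_def by simp
qed

lemma tendsto_koszul_minor:
  assumes "\<And>i j k. i \<in> {0..6} \<Longrightarrow> j \<in> J \<Longrightarrow> k \<in> K \<Longrightarrow> ((\<lambda>x. X x i j k) \<longlongrightarrow> Y i j k) F"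
  shows "((\<lambda>x. koszul_minor J K N lam mu (X x)) \<longlongrightarrow> koszul_minor J K N lam mu Y) F"
  unfolding koszul_minor_def
proof (rule tendsto_det)
  have "((\<lambda>x. koszul (X x) \<rho> \<kappa>) \<longlongrightarrow> koszul Y \<rho> \<kappa>) F" if "snd \<rho> \<in> J" "snd \<kappa> \<in> K" for \<rho> \<kappa>
    unfolding koszul_def by (intro tendsto_sum tendsto_mult_left assms that)
  then show "((\<lambda>x. \<Sum>\<rho>\<in>set triples \<times> J. \<Sum>\<kappa>\<in>set triples \<times> K. lam m \<rho> * mu n \<kappa> * koszul (X x) \<rho> \<kappa>) \<longlongrightarrow>
      (\<Sum>\<rho>\<in>set triples \<times> J. \<Sum>\<kappa>\<in>set triples \<times> K. lam m \<rho> * mu n \<kappa> * koszul Y \<rho> \<kappa>)) F" for m n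
    by (intro tendsto_sum tendsto_mult_left) auto
qed

lemma card_upper_triples: "card (set upper_triples) \<le> 20"
  using card_length[of upper_triples] by (simp add: upper_triples_eq)

text \<open>A summand contributes wedging with \<open>u l\<close> tensored with a rank-one matrix,
  and \<open>wedge_reduce\<close> factors this through the \<open>6 choose 3 = 20\<close> triples
  avoiding 0. All summands together factor through \<open>?M\<close>, with \<open>a\<close> and
  \<open>b\<close> the two compressed factors.\<close>

lemma koszul_minor_eq_0_generic:
  assumes X: "\<And>i j k. i \<in> {0..6} \<Longrightarrow> j \<in> J \<Longrightarrow> k \<in> K \<Longrightarrow> X i j k = (\<Sum>l<r. u l i * v l j * w l k)"
    and u: "\<And>l. l < r \<Longrightarrow> u l 0 \<noteq> 0" and "20 * r < N"
  shows "koszul_minor J K N lam mu X = 0"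
proof -
  let ?P = "set triples \<times> J" and ?Q = "set triples \<times> K" and ?M = "{..<r} \<times> set upper_triples"
  define a where "a m x = (\<Sum>\<rho>\<in>?P. lam m \<rho> * (v (fst x) (snd \<rho>) * reduce_triple (u (fst x)) (fst \<rho>) (snd x)))" for m x
  define b where "b n x = (\<Sum>\<kappa>\<in>?Q. mu n \<kappa> * (w (fst x) (snd \<kappa>) * wedge (u (fst x)) (snd x) (fst \<kappa>)))" for n x
  have koszul: "koszul X \<rho> \<kappa> = (\<Sum>x\<in>?M. (v (fst x) (snd \<rho>) * reduce_triple (u (fst x)) (fst \<rho>) (snd x)) *
      (w (fst x) (snd \<kappa>) * wedge (u (fst x)) (snd x) (fst \<kappa>)))" if "\<rho> \<in> ?P" "\<kappa> \<in> ?Q" for \<rho> \<kappa>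
  proof -
    have "koszul X \<rho> \<kappa> = (\<Sum>i\<in>{0..6}. \<Sum>l<r. u l i * of_int (sort_sign3 i (fst \<rho>) (fst \<kappa>)) * (v l (snd \<rho>) * w l (snd \<kappa>)))"
      unfolding koszul_def using that by (intro sum.cong refl) (auto simp: X sum_distrib_left mult_ac)
    also have "\<dots> = (\<Sum>l<r. wedge (u l) (fst \<rho>) (fst \<kappa>) * (v l (snd \<rho>) * w l (snd \<kappa>)))"
      unfolding wedge_def sum_distrib_right by (rule sum.swap)
    also have "\<dots> = (\<Sum>l<r. (\<Sum>Q\<in>set upper_triples. reduce_triple (u l) (fst \<rho>) Q * wedge (u l) Q (fst \<kappa>)) * (v l (snd \<rho>) * w l (snd \<kappa>)))"
      using that by (intro sum.cong refl arg_cong2[of _ _ _ _ "(*)"] wedge_reduce u) auto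
    finally show ?thesis
      by (simp add: sum.cartesian_product' sum_distrib_right sum_distrib_left mult_ac)
  qed
  have "(\<Sum>\<rho>\<in>?P. \<Sum>\<kappa>\<in>?Q. lam m \<rho> * mu n \<kappa> * koszul X \<rho> \<kappa>) = (\<Sum>x\<in>?M. a m x * b n x)" for m n
  proof -
    have "(\<Sum>\<rho>\<in>?P. \<Sum>\<kappa>\<in>?Q. lam m \<rho> * mu n \<kappa> * koszul X \<rho> \<kappa>) =
      (\<Sum>\<rho>\<in>?P. \<Sum>\<kappa>\<in>?Q. \<Sum>x\<in>?M. (lam m \<rho> * (v (fst x) (snd \<rho>) * reduce_triple (u (fst x)) (fst \<rho>) (snd x))) *
        (mu n \<kappa> * (w (fst x) (snd \<kappa>) * wedge (u (fst x)) (snd x) (fst \<kappa>))))"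
      by (intro sum.cong refl, subst koszul) (simp_all only: sum_distrib_left mult_ac)
    also have "\<dots> = (\<Sum>x\<in>?M. a m x * b n x)"
      unfolding a_def b_def sum_product by (simp only: sum.swap[of _ ?M])
    finally show ?thesis .
  qed
  moreover have "card ?M < N"
  proof -
    have "r * card (set upper_triples) \<le> r * 20"
      by (rule mult_le_mono2[OF card_upper_triples])
    then show ?thesis
      using \<open>20 * r < N\<close> unfolding card_cartesian_product card_lessThan by linarith
  qed
  ultimately show ?thesis
    unfolding koszul_minor_def using det_factor_eq_0[of ?M N a b] by simp
qed

lemma koszul_minor_eq_0_of_rank:
  assumes rank: "tensor_rank_le {0..6} J K X r" and "20 * r < N"
  shows "koszul_minor J K N lam mu X = 0"
proof -
  obtain u v w where X: "\<And>i j k. i \<in> {0..6} \<Longrightarrow> j \<in> J \<Longrightarrow> k \<in> K \<Longrightarrow> X i j k = (\<Sum>l<r. u l i * v l j * w l k)"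
    using rank unfolding tensor_rank_le_def by blast
  define t :: "nat \<Rightarrow> complex" where "t n = inverse (of_nat (Suc n))" for n
  have t_lim: "t \<longlonglongrightarrow> 0"
    unfolding t_def using LIMSEQ_Suc[OF lim_inverse_n] by (simp add: o_def)
  have t: "t n \<noteq> 0" for n
    unfolding t_def by (simp del: of_nat_Suc)
  \<comment> \<open>Perturb the pivot coordinate, which may vanish.\<close>
  define u' where "u' n l i = u l i + (if i = 0 then t n else 0)" for n l and i :: int
  have lim: "(\<lambda>n. u' n l i) \<longlonglongrightarrow> u l i" for l i
    using tendsto_add[OF tendsto_const[of "u l i"] t_lim] by (cases "i = 0") (simp_all add: u'_def)
  have "\<forall>\<^sub>F n in sequentially. u' n l 0 \<noteq> 0" for l
  proof (cases "u l 0 = 0")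
    case True
    then show ?thesis by (simp add: u'_def t)
  next
    case False
    then show ?thesis by (rule tendsto_imp_eventually_ne[OF lim])
  qed
  then have "\<forall>\<^sub>F n in sequentially. \<forall>l\<in>{..<r}. u' n l 0 \<noteq> 0"
    by (intro eventually_ball_finite) auto
  then have "\<forall>\<^sub>F n in sequentially. koszul_minor J K N lam mu (\<lambda>i j k. \<Sum>l<r. u' n l i * v l j * w l k) = 0"
    by eventually_elim (rule koszul_minor_eq_0_generic, use \<open>20 * r < N\<close> in auto)
  moreover have "(\<lambda>n. koszul_minor J K N lam mu (\<lambda>i j k. \<Sum>l<r. u' n l i * v l j * w l k)) \<longlonglongrightarrow>
      koszul_minor J K N lam mu (\<lambda>i j k. \<Sum>l<r. u l i * v l j * w l k)"
    by (intro tendsto_koszul_minor tendsto_sum tendsto_mult_right lim)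
  ultimately have "koszul_minor J K N lam mu (\<lambda>i j k. \<Sum>l<r. u l i * v l j * w l k) = 0"
    using tendsto_unique[OF sequentially_bot _ tendsto_eventually] by blast
  moreover have "koszul_minor J K N lam mu X = koszul_minor J K N lam mu (\<lambda>i j k. \<Sum>l<r. u l i * v l j * w l k)"
    by (rule koszul_minor_cong) (rule X)
  ultimately show ?thesis by simp
qed

lemma koszul_minor_eq_0:
  assumes br: "border_rank_le {0..6} J K X r" and "20 * r < N"
  shows "koszul_minor J K N lam mu X = 0"
proof -
  obtain S where S: "\<And>n. tensor_rank_le {0..6} J K (S n) r"
    "\<And>i j k. i \<in> {0..6} \<Longrightarrow> j \<in> J \<Longrightarrow> k \<in> K \<Longrightarrow> (\<lambda>n. S n i j k) \<longlonglongrightarrow> X i j k"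
    using br unfolding border_rank_le_def by blast
  have "(\<lambda>n. koszul_minor J K N lam mu (S n)) \<longlonglongrightarrow> koszul_minor J K N lam mu X"
    by (rule tendsto_koszul_minor) (rule S(2))
  then show ?thesis
    using koszul_minor_eq_0_of_rank[OF S(1) \<open>20 * r < N\<close>] by (simp add: LIMSEQ_const_iff)
qed

section \<open>Sparse Gaussian elimination\<close>

type_synonym svec = "(int \<times> int) list"

text \<open>Entries with equal keys are added, in whatever order they come, so that evaluation
  respects \<open>svec_comb\<close> on arbitrary lists. Sortedness only matters for success of the
  elimination, whose outcome is tested by \<open>echelon\<close>.\<close>

definition svec_eval :: "svec \<Rightarrow> int \<Rightarrow> int" where
  "svec_eval v c = (\<Sum>(k, x)\<leftarrow>v. if k = c then x else 0)"

fun svec_comb :: "int \<Rightarrow> svec \<Rightarrow> int \<Rightarrow> svec \<Rightarrow> svec" where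
  "svec_comb a [] b ys = map (\<lambda>(l, y). (l, b * y)) ys"
| "svec_comb a xs b [] = map (\<lambda>(k, x). (k, a * x)) xs"
| "svec_comb a ((k, x) # xs) b ((l, y) # ys) =
     (if k < l then (k, a * x) # svec_comb a xs b ((l, y) # ys)
      else if l < k then (l, b * y) # svec_comb a ((k, x) # xs) b ys
      else if a * x + b * y = 0 then svec_comb a xs b ys
      else (k, a * x + b * y) # svec_comb a xs b ys)"

lemma svec_eval_simps [simp]:
  "svec_eval [] c = 0" "svec_eval ((k, x) # v) c = (if k = c then x else 0) + svec_eval v c" "svec_eval (v @ w) c = svec_eval v c + svec_eval w c"
  by (simp_all add: svec_eval_def)

lemma svec_eval_scale: "svec_eval (map (\<lambda>(k, x). (k, a * x)) v) c = a * svec_eval v c"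
  by (induction v) (auto simp: distrib_left)

lemma svec_eval_comb: "svec_eval (svec_comb a xs b ys) c = a * svec_eval xs c + b * svec_eval ys c"
proof (induction a xs b ys rule: svec_comb.induct)
  case (3 a k x xs b l y ys)
  have "a * x + b * y = 0 \<Longrightarrow> a * (x + p) + b * (y + q) = a * p + b * q" for p q
    by (simp add: algebra_simps)
  with 3 show ?case by (auto simp: algebra_simps)
qed (simp_all add: svec_eval_scale distrib_left del: list.map)

text \<open>Fraction-free elimination on rows ordered by leading key. When two leading keys agree,
  the cross-multiplied leading terms cancel, so only the tails are combined.\<close>

fun insert_row :: "svec \<Rightarrow> svec list \<Rightarrow> svec list" where
  "insert_row [] B = B"
| "insert_row (x # r) [] = [x # r]"
| "insert_row (x # r) ([] # B) = insert_row (x # r) B"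
| "insert_row ((c, x) # r) (((d, y) # p) # B) =
     (if c < d then ((c, x) # r) # ((d, y) # p) # B
      else if d < c then ((d, y) # p) # insert_row ((c, x) # r) B
      else ((d, y) # p) # insert_row (svec_comb y r (- x) p) B)"

lemma svec_eval_insert_row:
  assumes closed: "\<And>f g a b. f \<in> V \<Longrightarrow> g \<in> V \<Longrightarrow> (\<lambda>c. a * f c + b * g c) \<in> V"
  shows "svec_eval r \<in> V \<Longrightarrow> \<forall>p\<in>set B. svec_eval p \<in> V \<Longrightarrow> \<forall>p\<in>set (insert_row r B). svec_eval p \<in> V"
proof (induction r B rule: insert_row.induct)
  case (4 c x r d y p B)
  have "svec_eval (svec_comb y r (- x) p) \<in> V" if "c = d"
  proof -
    have eq: "svec_eval (svec_comb y r (- x) p) = (\<lambda>e. y * svec_eval ((c, x) # r) e + (- x) * svec_eval ((d, y) # p) e)"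
      using that by (auto simp: svec_eval_comb fun_eq_iff algebra_simps)
    show ?thesis
      unfolding eq by (rule closed[OF "4.prems"(1) "4.prems"(2)[rule_format, OF list.set_intros(1)]])
  qed
  with 4 show ?case by (auto split: if_splits simp del: svec_eval_simps)
qed (auto simp del: svec_eval_simps)

text \<open>An executable certificate: \<open>n\<close> rows with nonzero, strictly increasing
  pivots above \<open>lo\<close> and at most \<open>hi\<close>. The window allows certificates to be
  glued.\<close>

fun echelon :: "int \<Rightarrow> svec list \<Rightarrow> int \<Rightarrow> int \<Rightarrow> bool" where
  "echelon lo [] hi n \<longleftrightarrow> lo \<le> hi \<and> n = 0"
| "echelon lo ([] # B) hi n \<longleftrightarrow> False"
| "echelon lo (((c, x) # r) # B) hi n \<longleftrightarrow> lo < c \<and> x \<noteq> 0 \<and> list_all (\<lambda>(d, y). c < d) r \<and> echelon c B hi (n - 1)"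

lemma echelon_append:
  "echelon lo B mid m \<Longrightarrow> echelon mid B' hi n \<Longrightarrow> echelon lo (B @ B') hi (m + n)"
proof (induction lo B mid m rule: echelon.induct)
  case (1 lo hi n')
  then show ?case
    by (cases B'; cases "hd B'") auto
next
  case (3 lo c x r B hi n')
  then show ?case by (simp add: algebra_simps)
qed auto

lemma echelon_length: "echelon lo B hi n \<Longrightarrow> int (length B) = n"
  by (induction lo B hi n rule: echelon.induct) auto

lemma svec_eval_eq_0: "list_all (\<lambda>(d, y). c < d) r \<Longrightarrow> e \<le> c \<Longrightarrow> svec_eval r e = 0"
  by (induction r) auto

lemma echelon_svec_eval_lower:
  "echelon lo B hi n \<Longrightarrow> i < length B \<Longrightarrow> e \<le> lo \<Longrightarrow> svec_eval (B ! i) e = 0"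
proof (induction lo B hi n arbitrary: i rule: echelon.induct)
  case (3 lo c x r B hi n)
  then show ?case by (cases i) (auto simp: svec_eval_eq_0)
qed auto

lemma echelon_triangular:
  "echelon lo B hi n \<Longrightarrow> i < length B \<Longrightarrow>
    svec_eval (B ! i) (fst (hd (B ! i))) \<noteq> 0 \<and> (\<forall>j<i. svec_eval (B ! i) (fst (hd (B ! j))) = 0)"
proof (induction lo B hi n arbitrary: i rule: echelon.induct)
  case (3 lo c x r B hi n)
  show ?case
  proof (cases i)
    case 0
    then show ?thesis using 3 by (auto simp: svec_eval_eq_0)
  next
    case (Suc i')
    have "svec_eval (B ! i') (fst (hd ((((c, x) # r) # B) ! j))) = 0" if "j < Suc i'" for j
      using that 3 Suc echelon_svec_eval_lower[of c B hi "n - 1" i' c] by (cases j) auto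
    then show ?thesis using 3 Suc by auto
  qed
qed auto

section \<open>The integer flattening matrix and its grading\<close>

definition pairs :: "(nat \<times> nat) list" where
  "pairs = [(0,1),(0,2),(0,3),(0,4),(1,2),(1,3),(1,4),(2,3),(2,4),(3,4)]"

text \<open>No coordinate subspace would do: leaving out one of the eight remaining slices gives rank at most 320.\<close>

definition slices :: "(nat \<times> nat) list list" where
  "slices = [[(0,3)],[(1,2)],[(1,3)],[(1,4)],[(2,3)],[(2,4)],[(0,4),(3,4)]]"

definition slice :: "int \<Rightarrow> nat \<times> nat \<Rightarrow> nat \<times> nat \<Rightarrow> int" where
  "slice i q k = (\<Sum>p\<leftarrow>slices ! nat i. bracket_form split_form p q k)"

fun disjoint3 :: "triple \<Rightarrow> triple \<Rightarrow> bool" where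
  "disjoint3 (a, b, c) (d, e, f) \<longleftrightarrow> a \<noteq> d \<and> a \<noteq> e \<and> a \<noteq> f \<and> b \<noteq> d \<and> b \<noteq> e \<and> b \<noteq> f \<and> c \<noteq> d \<and> c \<noteq> e \<and> c \<noteq> f"

fun notin3 :: "int \<Rightarrow> triple \<Rightarrow> bool" where
  "notin3 i (a, b, c) \<longleftrightarrow> i \<noteq> a \<and> i \<noteq> b \<and> i \<noteq> c"

text \<open>The nonzero signs in the row of \<open>S\<close>: \<open>R\<close> must be disjoint from
  \<open>S\<close>, and exactly one index \<open>i\<close> is then left over.\<close>

definition cofactors :: "triple \<Rightarrow> (triple \<times> int \<times> int) list" where
  "cofactors S = concat (map (\<lambda>R. map (\<lambda>i. (R, i, sort_sign3 i S R)) (filter (\<lambda>i. notin3 i S \<and> notin3 i R) [0,1,2,3,4,5,6]))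
      (filter (disjoint3 S) triples))"

definition slice_row :: "int \<Rightarrow> nat \<times> nat \<Rightarrow> ((nat \<times> nat) \<times> int) list" where
  "slice_row i q = filter (\<lambda>(k, v). v \<noteq> 0) (map (\<lambda>k. (k, slice i q k)) pairs)"

text \<open>A torus stabilises the chosen slices, so the flattening is graded: the rows of weight \<open>w\<close> only involve
  columns of weight \<open>1 - w\<close>. Columns are numbered by \<open>key\<close>, which sorts them first by weight, so that the
  blocks can be reduced separately and concatenated.\<close>

fun weight :: "triple \<Rightarrow> nat \<times> nat \<Rightarrow> int" where
  "weight (a, b, c) (d, e) =
     (let s = (\<lambda>i. [2, - 1, 0, - 2, 1, - 1, 0] ! nat i); v = (\<lambda>i. [1, - 1, 0, 1, - 1] ! i)
      in v d + v e - s a - s b - s c)"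

fun key :: "triple \<Rightarrow> nat \<times> nat \<Rightarrow> int" where
  "key (a, b, c) (d, e) = 10000 * weight (a, b, c) (d, e) + (5 * int d + int e) - 25 * (49 * a + 7 * b + c)"

text \<open>The columns of a row share one weight, \<open>triples\<close> is listed in decreasing
  order and \<open>pairs\<close> in increasing order, so the keys come out increasing, as the merge
  in \<open>svec_comb\<close> expects.\<close>

definition sparse_row :: "(triple \<times> int \<times> int) list \<Rightarrow> nat \<times> nat \<Rightarrow> svec" where
  "sparse_row cs q = concat (map (\<lambda>(R, i, e). map (\<lambda>(k, v). (key R k, e * v)) (slice_row i q)) cs)"

text \<open>Equal to a \<open>map\<close> over the filtered list; the case distinction postpones
  \<open>cofactors S\<close> until a row of weight \<open>w\<close> is known to exist.\<close>

definition sparse_rows :: "int \<Rightarrow> triple \<Rightarrow> svec list" where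
  "sparse_rows w S = (case filter (\<lambda>q. weight S q = w) pairs of [] \<Rightarrow> [] | q # qs \<Rightarrow> map (sparse_row (cofactors S)) (q # qs))"

definition block :: "int \<Rightarrow> svec list" where
  "block w = fold insert_row (concat (map (sparse_rows w) triples)) []"

section \<open>The sparse rows represent rows of the flattening\<close>

lemma set_pairs: "set pairs = so5_index"
  by (simp add: pairs_def so5_index_eq)

lemma distinct_pairs: "distinct pairs"
  by (simp add: pairs_def)

lemma distinct_triples: "distinct triples"
  by (simp add: triples_eq)

text \<open>Columns are addressed by \<open>key\<close>. Summing over all columns with a given key
  is itself a column combination, which \<open>mu\<close> reproduces in
  \<open>echelon_minor\<close>, so injectivity of \<open>key\<close> is never at issue.\<close>

definition koszul_row :: "triple \<times> (nat \<times> nat) \<Rightarrow> int \<Rightarrow> int" where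
  "koszul_row \<rho> c = (\<Sum>\<kappa>\<in>set triples \<times> so5_index. if key (fst \<kappa>) (snd \<kappa>) = c then koszul slice \<rho> \<kappa> else 0)"

definition row_space :: "(int \<Rightarrow> int) set" where
  "row_space = {g. \<exists>lam. \<forall>c. g c = (\<Sum>\<rho>\<in>set triples \<times> so5_index. lam \<rho> * koszul_row \<rho> c)}"

lemma row_space_closed:
  assumes "f \<in> row_space" "g \<in> row_space"
  shows "(\<lambda>c. a * f c + b * g c) \<in> row_space"
proof -
  obtain l m where l: "\<And>c. f c = (\<Sum>\<rho>\<in>set triples \<times> so5_index. l \<rho> * koszul_row \<rho> c)"
    and m: "\<And>c. g c = (\<Sum>\<rho>\<in>set triples \<times> so5_index. m \<rho> * koszul_row \<rho> c)"
    using assms unfolding row_space_def by blast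
  have "a * f c + b * g c = (\<Sum>\<rho>\<in>set triples \<times> so5_index. (a * l \<rho> + b * m \<rho>) * koszul_row \<rho> c)" for c
    unfolding l m by (simp add: sum_distrib_left sum.distrib distrib_right mult.assoc)
  then show ?thesis
    unfolding row_space_def by (intro CollectI exI[of _ "\<lambda>\<rho>. a * l \<rho> + b * m \<rho>"]) blast
qed

lemma koszul_row_row_space: "\<rho> \<in> set triples \<times> so5_index \<Longrightarrow> koszul_row \<rho> \<in> row_space"
proof -
  assume "\<rho> \<in> set triples \<times> so5_index"
  then have "koszul_row \<rho> c = (\<Sum>\<sigma>\<in>set triples \<times> so5_index. (if \<sigma> = \<rho> then 1 else 0) * koszul_row \<sigma> c)" for c
    by (simp add: mult_delta_left)
  then show ?thesis
    unfolding row_space_def by (intro CollectI exI[of _ "\<lambda>\<sigma>. if \<sigma> = \<rho> then 1 else 0"]) blast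
qed

lemma sort_sign3_eq_0: "\<not> disjoint3 S R \<Longrightarrow> sort_sign3 i S R = 0" "\<not> (notin3 i S \<and> notin3 i R) \<Longrightarrow> sort_sign3 i S R = 0"
  by (cases S; cases R; auto)+

lemma sum_list_map_concat: "(\<Sum>x\<leftarrow>concat xss. f x) = (\<Sum>xs\<leftarrow>xss. \<Sum>x\<leftarrow>xs. f x)"
  by (induction xss) auto

lemma sum_cofactors:
  fixes h :: "triple \<Rightarrow> int \<Rightarrow> int \<Rightarrow> int"
  assumes "\<And>R i. h R i 0 = 0"
  shows "(\<Sum>(R, i, e)\<leftarrow>cofactors S. h R i e) = (\<Sum>R\<in>set triples. \<Sum>i\<in>{0..6}. h R i (sort_sign3 i S R))"
proof -
  have "(\<Sum>(R, i, e)\<leftarrow>cofactors S. h R i e) = (\<Sum>R\<leftarrow>triples. if disjoint3 S R then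
      (\<Sum>i\<leftarrow>[0,1,2,3,4,5,6]. if notin3 i S \<and> notin3 i R then h R i (sort_sign3 i S R) else 0) else 0)"
    unfolding cofactors_def
    by (simp add: sum_list_map_concat o_def sum_list_map_filter' del: list.map filter.simps)
  also have "\<dots> = (\<Sum>R\<leftarrow>triples. \<Sum>i\<leftarrow>[0,1,2,3,4,5,6]. h R i (sort_sign3 i S R))"
  proof (intro arg_cong[of _ _ sum_list] map_cong refl)
    fix R
    have "(\<Sum>i\<leftarrow>xs. if notin3 i S \<and> notin3 i R then h R i (sort_sign3 i S R) else 0) = (\<Sum>i\<leftarrow>xs. h R i (sort_sign3 i S R))" for xs
      using sort_sign3_eq_0(2) assms by (intro arg_cong[of _ _ sum_list] map_cong refl) auto
    moreover have "(\<Sum>i\<leftarrow>xs. h R i (sort_sign3 i S R)) = 0" if "\<not> disjoint3 S R" for xs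
      using sort_sign3_eq_0(1)[OF that] assms by (simp add: sum_list_0)
    ultimately show "(if disjoint3 S R then
      (\<Sum>i\<leftarrow>[0,1,2,3,4,5,6]. if notin3 i S \<and> notin3 i R then h R i (sort_sign3 i S R) else 0) else 0)
      = (\<Sum>i\<leftarrow>[0,1,2,3,4,5,6]. h R i (sort_sign3 i S R))"
      by presburger
  qed
  also have "\<dots> = (\<Sum>R\<in>set triples. \<Sum>i\<in>set [0,1,2,3,4,5,6]. h R i (sort_sign3 i S R))"
    by (subst (1 2) sum_list_distinct_conv_sum_set) (simp_all add: distinct_triples)
  also have "set [0,1,2,3,4,5,6::int] = {0..6}" by auto
  finally show ?thesis .
qed

lemma sum_slice_row:
  assumes "\<And>k. h k 0 = (0::int)"
  shows "(\<Sum>(k, v)\<leftarrow>slice_row i q. h k v) = (\<Sum>k\<in>so5_index. h k (slice i q k))"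
proof -
  have "(\<Sum>(k, v)\<leftarrow>slice_row i q. h k v) = (\<Sum>k\<leftarrow>pairs. if slice i q k \<noteq> 0 then h k (slice i q k) else 0)"
    unfolding slice_row_def by (simp add: sum_list_map_filter' o_def filter_map)
  also have "\<dots> = (\<Sum>k\<leftarrow>pairs. h k (slice i q k))"
    using assms by (intro arg_cong[of _ _ sum_list] map_cong refl) auto
  also have "\<dots> = (\<Sum>k\<in>so5_index. h k (slice i q k))"
    by (simp add: sum_list_distinct_conv_sum_set distinct_pairs set_pairs)
  finally show ?thesis .
qed

lemma svec_eval_sparse_row:
  "svec_eval (sparse_row (cofactors S) q) c = koszul_row (S, q) c"
proof -
  have svec_eval_concat: "svec_eval (concat vs) c = (\<Sum>v\<leftarrow>vs. svec_eval v c)" for vs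
    by (induction vs) auto
  have "svec_eval (sparse_row (cofactors S) q) c =
      (\<Sum>(R, i, e)\<leftarrow>cofactors S. \<Sum>(k, v)\<leftarrow>slice_row i q. if key R k = c then e * v else 0)"
    unfolding sparse_row_def svec_eval_concat
    by (simp add: svec_eval_def o_def case_prod_unfold cong: if_cong)
  also have "\<dots> = (\<Sum>(R, i, e)\<leftarrow>cofactors S. \<Sum>k\<in>so5_index. if key R k = c then e * slice i q k else 0)"
    by (subst sum_slice_row) auto
  also have "\<dots> = (\<Sum>R\<in>set triples. \<Sum>i\<in>{0..6}. \<Sum>k\<in>so5_index. if key R k = c then sort_sign3 i S R * slice i q k else 0)"
    by (subst sum_cofactors) (auto cong: if_cong)
  also have "\<dots> = (\<Sum>R\<in>set triples. \<Sum>k\<in>so5_index. \<Sum>i\<in>{0..6}. if key R k = c then sort_sign3 i S R * slice i q k else 0)"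
    by (intro sum.cong refl sum.swap)
  also have "\<dots> = (\<Sum>R\<in>set triples. \<Sum>k\<in>so5_index. if key R k = c then koszul slice (S, q) (R, k) else 0)"
    by (intro sum.cong refl) (simp add: koszul_def)
  also have "\<dots> = koszul_row (S, q) c"
    by (simp add: koszul_row_def sum.cartesian_product')
  finally show ?thesis .
qed

lemma svec_eval_fold_insert_row:
  "\<forall>r\<in>set rs. svec_eval r \<in> row_space \<Longrightarrow> \<forall>p\<in>set B. svec_eval p \<in> row_space \<Longrightarrow>
    \<forall>p\<in>set (fold insert_row rs B). svec_eval p \<in> row_space"
proof (induction rs arbitrary: B)
  case (Cons r rs)
  have "\<forall>p\<in>set (insert_row r B). svec_eval p \<in> row_space"
    by (rule svec_eval_insert_row[OF row_space_closed _ Cons.prems(2)]) (use Cons.prems(1) in simp_all)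
  then show ?case
    using Cons.IH[of "insert_row r B"] Cons.prems(1) by simp
qed simp

lemma svec_eval_sparse_rows:
  assumes "r \<in> set (sparse_rows w S)" "S \<in> set triples"
  shows "svec_eval r \<in> row_space"
proof -
  have "sparse_rows w S = map (sparse_row (cofactors S)) (filter (\<lambda>q. weight S q = w) pairs)"
    unfolding sparse_rows_def by (simp split: list.split)
  then obtain q where "q \<in> set pairs" "r = sparse_row (cofactors S) q"
    using assms(1) by auto
  then have "svec_eval r = koszul_row (S, q)" "(S, q) \<in> set triples \<times> so5_index"
    using assms(2) by (auto simp: svec_eval_sparse_row set_pairs)
  then show ?thesis using koszul_row_row_space by simp
qed

lemma svec_eval_block: "\<forall>p\<in>set (block w). svec_eval p \<in> row_space"
  unfolding block_def by (rule svec_eval_fold_insert_row) (auto intro: svec_eval_sparse_rows)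

section \<open>From echelon form to a nonzero minor\<close>

lemma koszul_of_int: "koszul (\<lambda>i j k. of_int (X i j k)) \<rho> \<kappa> = of_int (koszul X \<rho> \<kappa>)"
  unfolding koszul_def by simp

text \<open>\<open>lam\<close> records how the echelon rows arise from rows of the flattening, and
  \<open>mu\<close> selects the pivot columns. The resulting matrix is upper triangular with the
  pivots on its diagonal.\<close>

lemma echelon_minor:
  assumes B: "\<forall>p\<in>set B. svec_eval p \<in> row_space" and ech: "echelon lo B hi n"
  shows "\<exists>lam mu. koszul_minor so5_index so5_index (length B) lam mu (\<lambda>i j k. of_int (slice i j k)) \<noteq> 0"
proof -
  let ?P = "set triples \<times> so5_index" and ?N = "length B"
  have "\<exists>l. \<forall>c. svec_eval (B ! m) c = (\<Sum>\<rho>\<in>?P. l \<rho> * koszul_row \<rho> c)" if "m < ?N" for m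
    using B nth_mem[OF that] unfolding row_space_def by blast
  then have "\<forall>m. \<exists>l. m < ?N \<longrightarrow> (\<forall>c. svec_eval (B ! m) c = (\<Sum>\<rho>\<in>?P. l \<rho> * koszul_row \<rho> c))"
    by blast
  from choice[OF this] obtain l where l: "\<And>m c. m < ?N \<Longrightarrow> svec_eval (B ! m) c = (\<Sum>\<rho>\<in>?P. l m \<rho> * koszul_row \<rho> c)"
    by blast
  define lead where "lead m = fst (hd (B ! m))" for m
  define mu :: "nat \<Rightarrow> triple \<times> (nat \<times> nat) \<Rightarrow> complex" where
    "mu m \<kappa> = (if key (fst \<kappa>) (snd \<kappa>) = lead m then 1 else 0)" for m \<kappa>
  define A where "A = Matrix.mat ?N ?N (\<lambda>(m, m'). complex_of_int (svec_eval (B ! m) (lead m')))"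
  have entry: "(\<Sum>\<rho>\<in>?P. \<Sum>\<kappa>\<in>?P. of_int (l m \<rho>) * mu m' \<kappa> * koszul (\<lambda>i j k. of_int (slice i j k)) \<rho> \<kappa>) =
      complex_of_int (svec_eval (B ! m) (lead m'))" if "m < ?N" for m m'
  proof -
    have "complex_of_int (svec_eval (B ! m) (lead m')) = (\<Sum>\<rho>\<in>?P. \<Sum>\<kappa>\<in>?P. of_int (l m \<rho>) *
        of_int (if key (fst \<kappa>) (snd \<kappa>) = lead m' then koszul slice \<rho> \<kappa> else 0))"
      unfolding l[OF that] koszul_row_def by (simp only: of_int_sum of_int_mult sum_distrib_left)
    also have "\<dots> = (\<Sum>\<rho>\<in>?P. \<Sum>\<kappa>\<in>?P. of_int (l m \<rho>) * mu m' \<kappa> * koszul (\<lambda>i j k. of_int (slice i j k)) \<rho> \<kappa>)"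
      unfolding koszul_of_int mu_def by (intro sum.cong refl) simp
    finally show ?thesis ..
  qed
  have "koszul_minor so5_index so5_index ?N (\<lambda>m \<rho>. of_int (l m \<rho>)) mu (\<lambda>i j k. of_int (slice i j k)) = Determinant.det A"
    unfolding koszul_minor_def A_def
    by (rule arg_cong[of _ _ Determinant.det], rule cong_mat) (simp_all add: entry)
  moreover have "Determinant.det A = prod_list (diag_mat A)"
    by (rule det_upper_triangular[of _ ?N])
      (use echelon_triangular[OF ech] in \<open>auto simp: A_def upper_triangular_def lead_def\<close>)
  moreover have "prod_list (diag_mat A) \<noteq> 0"
    using echelon_triangular[OF ech] by (auto simp: prod_list_zero_iff diag_mat_def A_def lead_def)
  ultimately show ?thesis by metis
qed

section \<open>The seven slices and the final count\<close>

lemma of_int_bracket_form: "of_int (bracket_form split_form p q k) = bracket_tensor p q k"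
  by (cases p; cases q; cases k) (simp add: split_form_def)

lemma border_rank_le_slices:
  assumes "border_rank_le (so5_index - {(0,1), (0,2)}) so5_index so5_index bracket_tensor r"
  shows "border_rank_le {0..6} so5_index so5_index (\<lambda>i j k. of_int (slice i j k)) r"
proof -
  define f :: "int \<Rightarrow> nat \<times> nat \<Rightarrow> complex" where "f i a = (if a \<in> set (slices ! nat i) then 1 else 0)" for i a
  from border_rank_le_slice_map[OF assms, of "{0..6}" f]
  have "border_rank_le {0..6} so5_index so5_index (slice_map (so5_index - {(0,1), (0,2)}) f bracket_tensor) r"
    by simp
  then show ?thesis
  proof (rule border_rank_le_cong)
    fix i :: int and b c assume "i \<in> {0..6}"
    then have "i = 0 \<or> i = 1 \<or> i = 2 \<or> i = 3 \<or> i = 4 \<or> i = 5 \<or> i = 6" by auto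
    moreover have "so5_index - {(0,1), (0,2)} = {(0,3),(0,4),(1,2),(1,3),(1,4),(2,3),(2,4),(3,4)}"
      by (auto simp: so5_index_eq)
    ultimately show "slice_map (so5_index - {(0,1), (0,2)}) f bracket_tensor i b c = of_int (slice i b c)"
      unfolding slice_map_def slice_def
      by (elim disjE) (simp_all add: f_def slices_def of_int_bracket_form del: bracket_form.simps)
  qed
qed

text \<open>The torus gives \<open>f\<^sub>0, ..., f\<^sub>4\<close> the weights 1, -1, 0, 1, -1, so
  that the summands \<open>(0,4)\<close> and \<open>(3,4)\<close> of the last slice share weight 0.
  The slice weights add up to -1, which is why row and column weights of a nonzero entry add up to
  1. The flattening matrix is symmetric, since signs and slices both change sign under exchange;
  hence the ranks for \<open>w\<close> and \<open>1 - w\<close> agree.\<close>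

lemma blocks_echelon:
  "list_all (\<lambda>(w, n). echelon (1000 - 10000 * w) (block w) (11000 - 10000 * w) n)
     [(6, 1), (5, 6), (4, 17), (3, 33), (2, 47), (1, 57), (0, 57), (- 1, 47), (- 2, 33), (- 3, 17), (- 4, 6), (- 5, 1)]"
  by code_simp

text \<open>Keys of column weight \<open>1 - w\<close> lie between \<open>1000 - 10000 * w\<close>
  and \<open>11000 - 10000 * w\<close>, and the latter is where the window for \<open>w - 1\<close>
  begins.\<close>

lemma echelon_concat:
  assumes "successively (\<lambda>(w, n) (w', n'). w' = w - 1) ws" "ws \<noteq> []"
    and "list_all (\<lambda>(w, n). echelon (1000 - 10000 * w) (block w) (11000 - 10000 * w) n) ws"
  shows "echelon (1000 - 10000 * fst (hd ws)) (concat (map (\<lambda>(w, n). block w) ws))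
    (11000 - 10000 * fst (last ws)) (\<Sum>(w, n)\<leftarrow>ws. n)"
  using assms
proof (induction ws rule: induct_list012)
  case (3 x y zs)
  obtain w n w' n' where xy: "x = (w, n)" "y = (w', n')" by (cases x; cases y) blast
  have ech: "echelon (1000 - 10000 * w) (block w) (1000 - 10000 * w') n"
    using 3 unfolding xy by simp
  moreover have "echelon (1000 - 10000 * fst (hd (y # zs))) (concat (map (\<lambda>(w, n). block w) (y # zs)))
    (11000 - 10000 * fst (last (y # zs))) (\<Sum>(w, n)\<leftarrow>y # zs. n)"
    by (rule "3.IH"(2)) (use "3.prems" in simp_all)
  ultimately have "echelon (1000 - 10000 * w) (block w @ concat (map (\<lambda>(w, n). block w) (y # zs)))
    (11000 - 10000 * fst (last (y # zs))) (n + (\<Sum>(w, n)\<leftarrow>y # zs. n))"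
    using echelon_append[OF ech] unfolding xy by simp
  then show ?case unfolding xy by simp
qed auto

lemma slices_border_rank:
  assumes "border_rank_le {0..6} so5_index so5_index (\<lambda>i j k. of_int (slice i j k)) r"
  shows "r > 16"
proof (rule ccontr)
  assume "\<not> r > 16"
  let ?ws = "[(6, 1), (5, 6), (4, 17), (3, 33), (2, 47), (1, 57), (0, 57), (- 1, 47), (- 2, 33), (- 3, 17), (- 4, 6), (- 5, 1)] :: (int \<times> int) list"
  define B where "B = concat (map (\<lambda>(w, n). block w) ?ws)"
  have ech: "echelon (1000 - 10000 * fst (hd ?ws)) B (11000 - 10000 * fst (last ?ws)) (\<Sum>(w, n)\<leftarrow>?ws. n)"
    unfolding B_def by (rule echelon_concat[OF _ _ blocks_echelon]) simp_all
  have "length B = 322"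
    using echelon_length[OF ech] by simp
  moreover have "\<forall>p\<in>set B. svec_eval p \<in> row_space"
    using svec_eval_block unfolding B_def by auto
  ultimately obtain lam mu where
    "koszul_minor so5_index so5_index 322 lam mu (\<lambda>i j k. of_int (slice i j k)) \<noteq> 0"
    using echelon_minor[OF _ ech] by metis
  then show False
    using koszul_minor_eq_0[OF assms] \<open>\<not> r > 16\<close> by simp
qed

theorem theorem5:
  shows "border_rank so5_index so5_index so5_index T_so5 \<ge> 19"
proof (rule ccontr)
  assume less: "\<not> border_rank so5_index so5_index so5_index T_so5 \<ge> 19"
  obtain r where "tensor_rank_le so5_index so5_index so5_index T_so5 r"
    using tensor_rank_le_exists[OF finite_so5_index finite_so5_index] by blast
  then have "border_rank_le so5_index so5_index so5_index T_so5 r"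
    by (intro border_rank_leI[where S = "\<lambda>_. T_so5"]) simp_all
  then have "border_rank_le so5_index so5_index so5_index T_so5 (border_rank so5_index so5_index so5_index T_so5)"
    unfolding border_rank_def by (rule LeastI)
  then have "border_rank_le so5_index so5_index so5_index T_so5 (Suc (Suc 16))"
    by (rule border_rank_le_mono) (use less in simp)
  from slices_border_rank[OF border_rank_le_slices[OF border_rank_le_restricted[OF this]]]
  show False by simp
qed

end
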